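(* Let $A=A(\mathbf q,a_1,\dots,a_n)$ be a quantum complete intersection over a field $k$ (with $n\ge2$, all $a_i\ge2$, $\mathbf q=(q_{ij})$). Assume that $\sqrt{-1}\in k$ and $q_{ij}^2=1$ for $1\le i,j\le n$. Then $A$ admits a bi-Frobenius algebra structure. Moreover, if there is an $a_i$ which is not a power of $\mathrm{char}\,k$ (in particular, if $\mathrm{char}\,k=0$), then $A$ admits no bialgebra structure, hence no Hopf algebra structure.
   Context: Let $k$ be a field, $n\ge 2$, $a_1,\dots,a_n\ge 2$ integers, and $\mathbf q=(q_{ij})$ an $n\times n$ matrix over $k$ with $q_{ii}=-1$ and $q_{ij}q_{ji}=1$ for all $i,j$. The quantum complete intersection is the $k$-algebra $A(\mathbf q,a_1,\dots,a_n)=k\langle x_1,\dots,x_n\rangle/\langle x_i^{a_i},\ x_ix_j+q_{ij}x_jx_i,\ 1\le i,j\le n\rangle$. Bi-Frobenius algebras. Let $A$ be a finite-dimensional algebra that is also a coalgebra over $k$ (no compatibility assumed), with comultiplication $\Delta$ and counit $\varepsilon$; let $t\in A$, $\phi\in A^*=\mathrm{Hom}_k(A,k)$, and let $S:A\to A$ be the linear map $S(a)=\sum\phi(t_1a)t_2$, where $\Delta(t)=\sum t_1\otimes t_2$. The quadruple $(A,\phi,t,S)$ is a bi-Frobenius algebra if: (i) $\varepsilon$ is an algebra homomorphism and $1_A$ is group-like; (ii) $(A,\phi)$ is a Frobenius algebra, i.e. $A^*=A\rightharpoonup\phi$ where $(a\rightharpoonup\phi)(x)=\phi(xa)$, and $(A,t)$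 is a Frobenius coalgebra, i.e. $A=t\leftharpoonup A^*$ where $t\leftharpoonup f=\sum f(t_1)t_2$; (iii) $S$ is an algebra anti-homomorphism and a coalgebra anti-homomorphism (i.e. $\varepsilon\circ S=\varepsilon$ and $\Delta(S(a))=\sum S(a_2)\otimes S(a_1)$ for all $a\in A$). An algebra "admits a bi-Frobenius algebra (bialgebra, Hopf algebra) structure" if there are structure maps on the given algebra making it such an object. *)

theory Defs
  imports
    "HOL-Library.Poly_Mapping"
    "HOL-Algebra.QuotRing"
    "HOL-Algebra.Module"
begin

section \<open>Vector spaces and algebras over a field\<close>

text \<open>
  The ground field is a type \<open>'k\<close> of class \<^class>\<open>field\<close>.  Vector spaces and algebras over it
  are \<open>('k, 'a) module\<close> records; for plain vector spaces the fields \<open>mult\<close> and \<open>one\<close> are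
  irrelevant.  The locale \<^locale>\<open>algebra\<close> of HOL-Algebra covers commutative algebras only, hence
  the separate predicate below.
\<close>

definition base_field :: "('k::field, 'k) module" where
  "base_field = \<lparr>carrier = UNIV, mult = (*), one = 1, zero = 0, add = (+), smult = (*)\<rparr>"

definition vector_space_record :: "('k::field, 'a, 'm) module_scheme \<Rightarrow> bool" where
  "vector_space_record V \<longleftrightarrow> Module.module (base_field :: ('k, 'k) module) V"

definition finite_dimensional :: "('k::field, 'a, 'm) module_scheme \<Rightarrow> bool" where
  "finite_dimensional V \<longleftrightarrow>
     (\<exists>B. finite B \<and> B \<subseteq> carrier V \<and>
        (\<forall>v\<in>carrier V. \<exists>c. v = (\<Oplus>\<^bsub>V\<^esub>b\<in>B. c b \<odot>\<^bsub>V\<^esub> b)))"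

definition linear_maps ::
  "('k::field, 'a, 'm) module_scheme \<Rightarrow> ('k, 'b, 'l) module_scheme \<Rightarrow> ('a \<Rightarrow> 'b) set" where
  "linear_maps V W =
     {f \<in> carrier V \<rightarrow> carrier W.
        (\<forall>x\<in>carrier V. \<forall>y\<in>carrier V. f (x \<oplus>\<^bsub>V\<^esub> y) = f x \<oplus>\<^bsub>W\<^esub> f y) \<and>
        (\<forall>c. \<forall>x\<in>carrier V. f (c \<odot>\<^bsub>V\<^esub> x) = c \<odot>\<^bsub>W\<^esub> f x)}"

abbreviation dual_space :: "('k::field, 'a, 'm) module_scheme \<Rightarrow> ('a \<Rightarrow> 'k) set" where
  "dual_space V \<equiv> linear_maps V base_field"

definition assoc_algebra :: "('k::field, 'a, 'm) module_scheme \<Rightarrow> bool" where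
  "assoc_algebra A \<longleftrightarrow> ring A \<and> vector_space_record A \<and>
     (\<forall>c. \<forall>x\<in>carrier A. \<forall>y\<in>carrier A.
        (c \<odot>\<^bsub>A\<^esub> x) \<otimes>\<^bsub>A\<^esub> y = c \<odot>\<^bsub>A\<^esub> (x \<otimes>\<^bsub>A\<^esub> y) \<and>
        x \<otimes>\<^bsub>A\<^esub> (c \<odot>\<^bsub>A\<^esub> y) = c \<odot>\<^bsub>A\<^esub> (x \<otimes>\<^bsub>A\<^esub> y))"

definition algebra_hom ::
  "('k::field, 'a, 'm) module_scheme \<Rightarrow> ('k, 'b, 'l) module_scheme \<Rightarrow> ('a \<Rightarrow> 'b) set" where
  "algebra_hom A B = linear_maps A B \<inter> ring_hom A B"

definition algebra_antihom ::
  "('k::field, 'a, 'm) module_scheme \<Rightarrow> ('k, 'b, 'l) module_scheme \<Rightarrow> ('a \<Rightarrow> 'b) set" where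
  "algebra_antihom A B =
     {f \<in> linear_maps A B.
        (\<forall>x\<in>carrier A. \<forall>y\<in>carrier A. f (x \<otimes>\<^bsub>A\<^esub> y) = f y \<otimes>\<^bsub>B\<^esub> f x) \<and> f \<one>\<^bsub>A\<^esub> = \<one>\<^bsub>B\<^esub>}"


section \<open>Tensor products\<close>

text \<open>
  \<open>V \<otimes> W\<close> is the free vector space on \<open>carrier V \<times> carrier W\<close> modulo the subspace
  \<open>tensor_null V W\<close> spanned by the bilinearity relations; its elements are cosets.
\<close>

abbreviation scale :: "'k::field \<Rightarrow> ('b \<Rightarrow>\<^sub>0 'k) \<Rightarrow> ('b \<Rightarrow>\<^sub>0 'k)" where
  "scale c p \<equiv> Poly_Mapping.map ((*) c) p"

inductive_set tensor_null ::
  "('k::field, 'a, 'm) module_scheme \<Rightarrow> ('k, 'b, 'l) module_scheme \<Rightarrow> ('a \<times> 'b \<Rightarrow>\<^sub>0 'k) set"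
  for V :: "('k::field, 'a, 'm) module_scheme" and W :: "('k, 'b, 'l) module_scheme"
where
  zero: "0 \<in> tensor_null V W"
| add: "p \<in> tensor_null V W \<Longrightarrow> p' \<in> tensor_null V W \<Longrightarrow> p + p' \<in> tensor_null V W"
| scale: "p \<in> tensor_null V W \<Longrightarrow> scale c p \<in> tensor_null V W"
| add_left: "v \<in> carrier V \<Longrightarrow> v' \<in> carrier V \<Longrightarrow> w \<in> carrier W \<Longrightarrow>
    Poly_Mapping.single (v \<oplus>\<^bsub>V\<^esub> v', w) 1 - Poly_Mapping.single (v, w) 1
      - Poly_Mapping.single (v', w) 1 \<in> tensor_null V W"
| add_right: "v \<in> carrier V \<Longrightarrow> w \<in> carrier W \<Longrightarrow> w' \<in> carrier W \<Longrightarrow>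
    Poly_Mapping.single (v, w \<oplus>\<^bsub>W\<^esub> w') 1 - Poly_Mapping.single (v, w) 1
      - Poly_Mapping.single (v, w') 1 \<in> tensor_null V W"
| smult_left: "v \<in> carrier V \<Longrightarrow> w \<in> carrier W \<Longrightarrow>
    Poly_Mapping.single (c \<odot>\<^bsub>V\<^esub> v, w) 1 - Poly_Mapping.single (v, w) c \<in> tensor_null V W"
| smult_right: "v \<in> carrier V \<Longrightarrow> w \<in> carrier W \<Longrightarrow>
    Poly_Mapping.single (v, c \<odot>\<^bsub>W\<^esub> w) 1 - Poly_Mapping.single (v, w) c \<in> tensor_null V W"

definition tensor_class ::
  "('k::field, 'a, 'm) module_scheme \<Rightarrow> ('k, 'b, 'l) module_scheme \<Rightarrow>
     ('a \<times> 'b \<Rightarrow>\<^sub>0 'k) \<Rightarrow> ('a \<times> 'b \<Rightarrow>\<^sub>0 'k) set" where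
  "tensor_class V W p = {p'. p' - p \<in> tensor_null V W}"

definition pure_tensor ::
  "('k::field, 'a, 'm) module_scheme \<Rightarrow> ('k, 'b, 'l) module_scheme \<Rightarrow>
     'a \<Rightarrow> 'b \<Rightarrow> ('a \<times> 'b \<Rightarrow>\<^sub>0 'k) set" where
  "pure_tensor V W v w = tensor_class V W (Poly_Mapping.single (v, w) 1)"

text \<open>Bilinear extension of \<open>(v, w) (v', w') = (v v', w w')\<close> to the free vector space.\<close>

definition free_tensor_mult ::
  "('k::field, 'a, 'm) module_scheme \<Rightarrow> ('k, 'b, 'l) module_scheme \<Rightarrow>
     ('a \<times> 'b \<Rightarrow>\<^sub>0 'k) \<Rightarrow> ('a \<times> 'b \<Rightarrow>\<^sub>0 'k) \<Rightarrow> ('a \<times> 'b \<Rightarrow>\<^sub>0 'k)" where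
  "free_tensor_mult V W p p' =
     (\<Sum>(v, w)\<in>Poly_Mapping.keys p. \<Sum>(v', w')\<in>Poly_Mapping.keys p'.
        Poly_Mapping.single (v \<otimes>\<^bsub>V\<^esub> v', w \<otimes>\<^bsub>W\<^esub> w')
          (Poly_Mapping.lookup p (v, w) * Poly_Mapping.lookup p' (v', w')))"

text \<open>
  The unions below range over representatives of the cosets; the operations do not depend on the
  representative.
\<close>

definition tensor_prod ::
  "('k::field, 'a, 'm) module_scheme \<Rightarrow> ('k, 'b, 'l) module_scheme \<Rightarrow>
     ('k, ('a \<times> 'b \<Rightarrow>\<^sub>0 'k) set) module" where
  "tensor_prod V W =
     \<lparr>carrier = tensor_class V W ` {p. Poly_Mapping.keys p \<subseteq> carrier V \<times> carrier W},
      mult = (\<lambda>X Y. \<Union>p\<in>X. \<Union>p'\<in>Y. tensor_class V W (free_tensor_mult V W p p')),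
      one = pure_tensor V W \<one>\<^bsub>V\<^esub> \<one>\<^bsub>W\<^esub>,
      zero = tensor_class V W 0,
      add = (\<lambda>X Y. \<Union>p\<in>X. \<Union>p'\<in>Y. tensor_class V W (p + p')),
      smult = (\<lambda>c X. \<Union>p\<in>X. tensor_class V W (scale c p))\<rparr>"

text \<open>
  \<open>tensor_lift U \<beta> X\<close> is the value at \<open>X\<close> of the linear map \<open>V \<otimes> W \<rightarrow> U\<close> induced by a bilinear
  map \<open>\<beta>\<close> from \<open>V \<times> W\<close> to \<open>U\<close>.  It is used only for bilinear \<open>\<beta>\<close>, where the choice of the
  representative of \<open>X\<close> does not matter.  In Sweedler notation, \<open>\<Sum> \<beta> a\<^sub>1 a\<^sub>2\<close> is
  \<open>tensor_lift U \<beta> (\<Delta> a)\<close>.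
\<close>

definition tensor_lift ::
  "('k::field, 'c, 'n) module_scheme \<Rightarrow> ('a \<Rightarrow> 'b \<Rightarrow> 'c) \<Rightarrow> ('a \<times> 'b \<Rightarrow>\<^sub>0 'k) set \<Rightarrow> 'c" where
  "tensor_lift U \<beta> X =
     (let p = (SOME p. p \<in> X) in
        \<Oplus>\<^bsub>U\<^esub>vw\<in>Poly_Mapping.keys p. Poly_Mapping.lookup p vw \<odot>\<^bsub>U\<^esub> \<beta> (fst vw) (snd vw))"


section \<open>Coalgebras, bialgebras, Hopf algebras, bi-Frobenius algebras\<close>

text \<open>
  Coassociativity is stated in \<open>C \<otimes> (C \<otimes> C)\<close>, after identifying \<open>(C \<otimes> C) \<otimes> C\<close> with it.
\<close>

definition coalgebra ::
  "('k::field, 'a, 'm) module_scheme \<Rightarrow> ('a \<Rightarrow> ('a \<times> 'a \<Rightarrow>\<^sub>0 'k) set) \<Rightarrow> ('a \<Rightarrow> 'k) \<Rightarrow> bool" where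
  "coalgebra C \<Delta> \<epsilon> \<longleftrightarrow>
     vector_space_record C \<and>
     \<Delta> \<in> linear_maps C (tensor_prod C C) \<and>
     \<epsilon> \<in> dual_space C \<and>
     (\<forall>a\<in>carrier C.
        (let CC = tensor_prod C C; CCC = tensor_prod C CC in
           tensor_lift CCC (\<lambda>a1 a2. pure_tensor C CC a1 (\<Delta> a2)) (\<Delta> a) =
           tensor_lift CCC
             (\<lambda>a1 a2. tensor_lift CCC
                (\<lambda>a11 a12. pure_tensor C CC a11 (pure_tensor C C a12 a2)) (\<Delta> a1)) (\<Delta> a))) \<and>
     (\<forall>a\<in>carrier C. tensor_lift C (\<lambda>a1 a2. \<epsilon> a1 \<odot>\<^bsub>C\<^esub> a2) (\<Delta> a) = a) \<and>
     (\<forall>a\<in>carrier C. tensor_lift C (\<lambda>a1 a2. \<epsilon> a2 \<odot>\<^bsub>C\<^esub> a1) (\<Delta> a) = a)"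

definition bialgebra ::
  "('k::field, 'a, 'm) module_scheme \<Rightarrow> ('a \<Rightarrow> ('a \<times> 'a \<Rightarrow>\<^sub>0 'k) set) \<Rightarrow> ('a \<Rightarrow> 'k) \<Rightarrow> bool" where
  "bialgebra A \<Delta> \<epsilon> \<longleftrightarrow>
     assoc_algebra A \<and> coalgebra A \<Delta> \<epsilon> \<and>
     \<Delta> \<in> algebra_hom A (tensor_prod A A) \<and> \<epsilon> \<in> algebra_hom A base_field"

definition hopf_algebra ::
  "('k::field, 'a, 'm) module_scheme \<Rightarrow> ('a \<Rightarrow> ('a \<times> 'a \<Rightarrow>\<^sub>0 'k) set) \<Rightarrow> ('a \<Rightarrow> 'k) \<Rightarrow>
     ('a \<Rightarrow> 'a) \<Rightarrow> bool" where
  "hopf_algebra A \<Delta> \<epsilon> S \<longleftrightarrow>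
     bialgebra A \<Delta> \<epsilon> \<and> S \<in> linear_maps A A \<and>
     (\<forall>a\<in>carrier A.
        tensor_lift A (\<lambda>a1 a2. S a1 \<otimes>\<^bsub>A\<^esub> a2) (\<Delta> a) = \<epsilon> a \<odot>\<^bsub>A\<^esub> \<one>\<^bsub>A\<^esub> \<and>
        tensor_lift A (\<lambda>a1 a2. a1 \<otimes>\<^bsub>A\<^esub> S a2) (\<Delta> a) = \<epsilon> a \<odot>\<^bsub>A\<^esub> \<one>\<^bsub>A\<^esub>)"

definition group_like ::
  "('k::field, 'a, 'm) module_scheme \<Rightarrow> ('a \<Rightarrow> ('a \<times> 'a \<Rightarrow>\<^sub>0 'k) set) \<Rightarrow> ('a \<Rightarrow> 'k) \<Rightarrow> 'a \<Rightarrow> bool" where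
  "group_like C \<Delta> \<epsilon> g \<longleftrightarrow> g \<in> carrier C \<and> \<Delta> g = pure_tensor C C g g \<and> \<epsilon> g = 1"

text \<open>
  \<open>A\<^sup>* = A \<rightharpoonup> \<phi>\<close> with \<open>(a \<rightharpoonup> \<phi>) x = \<phi> (x a)\<close>; the inclusion of the right-hand side in
  the left-hand side is automatic for linear \<open>\<phi>\<close>.
\<close>

definition frobenius_algebra ::
  "('k::field, 'a, 'm) module_scheme \<Rightarrow> ('a \<Rightarrow> 'k) \<Rightarrow> bool" where
  "frobenius_algebra A \<phi> \<longleftrightarrow>
     \<phi> \<in> dual_space A \<and>
     (\<forall>f\<in>dual_space A. \<exists>a\<in>carrier A. \<forall>x\<in>carrier A. f x = \<phi> (x \<otimes>\<^bsub>A\<^esub> a))"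

text \<open>\<open>C = t \<leftharpoonup> C\<^sup>*\<close> with \<open>t \<leftharpoonup> f = \<Sum> f(t\<^sub>1) t\<^sub>2\<close>.\<close>

definition frobenius_coalgebra ::
  "('k::field, 'a, 'm) module_scheme \<Rightarrow> ('a \<Rightarrow> ('a \<times> 'a \<Rightarrow>\<^sub>0 'k) set) \<Rightarrow> 'a \<Rightarrow> bool" where
  "frobenius_coalgebra C \<Delta> t \<longleftrightarrow>
     t \<in> carrier C \<and>
     (\<forall>c\<in>carrier C. \<exists>f\<in>dual_space C. c = tensor_lift C (\<lambda>t1 t2. f t1 \<odot>\<^bsub>C\<^esub> t2) (\<Delta> t))"

definition coalgebra_antihom ::
  "('k::field, 'a, 'm) module_scheme \<Rightarrow> ('a \<Rightarrow> ('a \<times> 'a \<Rightarrow>\<^sub>0 'k) set) \<Rightarrow> ('a \<Rightarrow> 'k) \<Rightarrow>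
     ('a \<Rightarrow> 'a) \<Rightarrow> bool" where
  "coalgebra_antihom C \<Delta> \<epsilon> S \<longleftrightarrow>
     S \<in> linear_maps C C \<and>
     (\<forall>a\<in>carrier C. \<epsilon> (S a) = \<epsilon> a) \<and>
     (\<forall>a\<in>carrier C.
        \<Delta> (S a) = tensor_lift (tensor_prod C C) (\<lambda>a1 a2. pure_tensor C C (S a2) (S a1)) (\<Delta> a))"

definition bi_frobenius_algebra ::
  "('k::field, 'a, 'm) module_scheme \<Rightarrow> ('a \<Rightarrow> ('a \<times> 'a \<Rightarrow>\<^sub>0 'k) set) \<Rightarrow> ('a \<Rightarrow> 'k) \<Rightarrow>
     ('a \<Rightarrow> 'k) \<Rightarrow> 'a \<Rightarrow> ('a \<Rightarrow> 'a) \<Rightarrow> bool" where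
  "bi_frobenius_algebra A \<Delta> \<epsilon> \<phi> t S \<longleftrightarrow>
     assoc_algebra A \<and> finite_dimensional A \<and> coalgebra A \<Delta> \<epsilon> \<and>
     (\<forall>a\<in>carrier A. S a = tensor_lift A (\<lambda>t1 t2. \<phi> (t1 \<otimes>\<^bsub>A\<^esub> a) \<odot>\<^bsub>A\<^esub> t2) (\<Delta> t)) \<and>
     \<epsilon> \<in> algebra_hom A base_field \<and> group_like A \<Delta> \<epsilon> \<one>\<^bsub>A\<^esub> \<and>
     frobenius_algebra A \<phi> \<and> frobenius_coalgebra A \<Delta> t \<and>
     S \<in> algebra_antihom A A \<and> coalgebra_antihom A \<Delta> \<epsilon> S"

definition admits_bialgebra :: "('k::field, 'a, 'm) module_scheme \<Rightarrow> bool" where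
  "admits_bialgebra A \<longleftrightarrow> (\<exists>\<Delta> \<epsilon>. bialgebra A \<Delta> \<epsilon>)"

definition admits_hopf_algebra :: "('k::field, 'a, 'm) module_scheme \<Rightarrow> bool" where
  "admits_hopf_algebra A \<longleftrightarrow> (\<exists>\<Delta> \<epsilon> S. hopf_algebra A \<Delta> \<epsilon> S)"

definition admits_bi_frobenius_algebra :: "('k::field, 'a, 'm) module_scheme \<Rightarrow> bool" where
  "admits_bi_frobenius_algebra A \<longleftrightarrow> (\<exists>\<Delta> \<epsilon> \<phi> t S. bi_frobenius_algebra A \<Delta> \<epsilon> \<phi> t S)"


section \<open>Quantum complete intersections\<close>

text \<open>
  Lists form the free monoid under concatenation; with the additive instance below, multiplication
  on \<open>nat list \<Rightarrow>\<^sub>0 'k\<close> is that of the free algebra.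
\<close>

instantiation list :: (type) monoid_add
begin

definition zero_list :: "'a list" where "zero_list = []"
definition plus_list :: "'a list \<Rightarrow> 'a list \<Rightarrow> 'a list" where "plus_list = (@)"

instance by standard (simp_all add: zero_list_def plus_list_def)

end

definition free_algebra :: "nat \<Rightarrow> ('k::field, nat list \<Rightarrow>\<^sub>0 'k) module" where
  "free_algebra n =
     \<lparr>carrier = {p. \<forall>w\<in>Poly_Mapping.keys p. set w \<subseteq> {1..n}},
      mult = (*), one = 1, zero = 0, add = (+), smult = scale\<rparr>"

abbreviation gen :: "nat \<Rightarrow> (nat list \<Rightarrow>\<^sub>0 'k::field)" where
  "gen i \<equiv> Poly_Mapping.single [i] 1"

definition quotient_algebra ::
  "('k::field, 'a, 'm) module_scheme \<Rightarrow> 'a set \<Rightarrow> ('k, 'a set) module" where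
  "quotient_algebra A I =
     \<lparr>carrier = carrier (A Quot I), mult = mult (A Quot I), one = one (A Quot I),
      zero = zero (A Quot I), add = add (A Quot I),
      smult = (\<lambda>c X. \<Union>x\<in>X. I +>\<^bsub>A\<^esub> (c \<odot>\<^bsub>A\<^esub> x))\<rparr>"

definition qci_relations ::
  "nat \<Rightarrow> (nat \<Rightarrow> nat \<Rightarrow> 'k::field) \<Rightarrow> (nat \<Rightarrow> nat) \<Rightarrow> (nat list \<Rightarrow>\<^sub>0 'k) set" where
  "qci_relations n q a =
     {gen i ^ a i | i. i \<in> {1..n}} \<union>
     {gen i * gen j + scale (q i j) (gen j * gen i) | i j. i \<in> {1..n} \<and> j \<in> {1..n}}"

definition quantum_complete_intersection ::
  "nat \<Rightarrow> (nat \<Rightarrow> nat \<Rightarrow> 'k::field) \<Rightarrow> (nat \<Rightarrow> nat) \<Rightarrow> ('k, (nat list \<Rightarrow>\<^sub>0 'k) set) module" where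
  "quantum_complete_intersection n q a =
     quotient_algebra (free_algebra n) (Idl\<^bsub>free_algebra n\<^esub> (qci_relations n q a))"

end

theory Submission
  imports Defs "HOL-Library.Multiset" "HOL-Algebra.Exponent"
begin

text \<open>
  \<open>A\<close> has a basis of ordered monomials, indexed by the submultisets \<open>M\<close> of
  \<open>T = \<Sum>\<^sub>i (a\<^sub>i - 1) i\<close>. Take \<open>1\<close> group-like and every monomial other than \<open>1\<close> and
  the socle monomial \<open>t\<close> primitive, and let \<open>\<Delta> t\<close> pair each monomial with its complement; since
  the dual algebra is then \<open>k \<oplus> V \<oplus> k\<close> with a nondegenerate form on \<open>V\<close>, coassociativity is
  automatic, and the coefficients of \<open>\<Delta> t\<close> can be chosen such that \<open>S\<close> is the algebra
  anti-automorphism \<open>x\<^sub>i \<mapsto> l\<^sub>i x\<^sub>i\<close>. It reverses \<open>\<Delta> t\<close> provided that \<open>l\<^sub>i\<^sup>2\<close> is the sign by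
  which \<open>x\<^sub>i\<close> commutes with \<open>t\<close> and that \<open>S t = t\<close>.

  In a bialgebra the counit kills all \<open>x\<^sub>i\<close>, so \<open>\<Delta> x\<^sub>i = x\<^sub>i \<otimes> 1 + 1 \<otimes> x\<^sub>i\<close> up to terms in
  \<open>I \<otimes> I\<close> for the augmentation ideal \<open>I\<close>, and \<open>x\<^sub>i ^ a\<^sub>i = 0\<close> forces \<open>a\<^sub>i choose r = 0\<close> in \<open>k\<close> for
  \<open>0 < r < a\<^sub>i\<close>; hence \<open>a\<^sub>i\<close> is a power of the characteristic.
\<close>

section \<open>Vector spaces and coordinates\<close>

text \<open>Tensors are cosets evaluated through chosen representatives, so identities between them
  are tested by functionals: a basis of \<open>A\<close> with its dual functionals induces such
  bases on \<open>A \<otimes> A\<close> and \<open>A \<otimes> (A \<otimes> A)\<close>, and the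
  axioms become scalar identities between structure constants.

  The form of the antipode coefficients comes from a comparison. Let \<open>S\<close> scale
  \<open>e M\<close> by \<open>c M\<close>. For \<open>M + N\<close> below \<open>T\<close>,
  applying \<open>S\<close> to the product of \<open>e M\<close> and \<open>e N\<close> and
  reversing the factors gives \<open>\<kappa> M N * c (M + N) = \<kappa> N M * c M * c N\<close>. As
  all \<open>q i j\<close> square to 1, the values of \<open>\<kappa>\<close> are signs, so the
  quotient of the two signs is their product, the polarisation of the quadratic map
  \<open>\<kappa> M M\<close>. After division by that map \<open>c\<close> is multiplicative, hence
  determined by its values on generators, of which only the squares are prescribed.

  For the quotient the obstacle is linear independence of the ordered monomials. Instead of a
  confluence argument, explicit coordinates on words are shown to vanish on the ideal.\<close>

lemma base_field_simps [simp]: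
  "carrier base_field = UNIV" "monoid.mult base_field = (*)" "one base_field = 1"
  "zero base_field = 0" "add base_field = (+)" "smult base_field = (*)"
  by (simp_all add: base_field_def)

lemma cring_base_field: "cring (base_field :: ('k::field, 'k) module)"
proof (rule cringI)
  show "abelian_group (base_field :: ('k, 'k) module)"
    by (rule abelian_groupI) (auto simp: add.assoc add.commute intro: exI[of _ "- x" for x])
  show "comm_monoid (base_field :: ('k, 'k) module)"
    by (rule comm_monoidI) (auto simp: mult.assoc mult.commute)
qed (auto simp: algebra_simps)

lemma vector_space_recordI:
  assumes "abelian_group V"
    and "\<And>c x. x \<in> carrier V \<Longrightarrow> c \<odot>\<^bsub>V\<^esub> x \<in> carrier V"
    and "\<And>c d x. x \<in> carrier V \<Longrightarrow> (c + d) \<odot>\<^bsub>V\<^esub> x = c \<odot>\<^bsub>V\<^esub> x \<oplus>\<^bsub>V\<^esub> d \<odot>\<^bsub>V\<^esub> x"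
    and "\<And>c x y. x \<in> carrier V \<Longrightarrow> y \<in> carrier V \<Longrightarrow>
      c \<odot>\<^bsub>V\<^esub> (x \<oplus>\<^bsub>V\<^esub> y) = c \<odot>\<^bsub>V\<^esub> x \<oplus>\<^bsub>V\<^esub> c \<odot>\<^bsub>V\<^esub> y"
    and "\<And>c d x. x \<in> carrier V \<Longrightarrow> (c * d) \<odot>\<^bsub>V\<^esub> x = c \<odot>\<^bsub>V\<^esub> (d \<odot>\<^bsub>V\<^esub> x)"
    and "\<And>x. x \<in> carrier V \<Longrightarrow> 1 \<odot>\<^bsub>V\<^esub> x = x"
  shows "vector_space_record (V :: ('k::field, 'a, 'm) module_scheme)"
  unfolding vector_space_record_def
  using assms by (intro moduleI) (auto simp: cring_base_field)

lemma
  assumes "vector_space_record (V :: ('k::field, 'a, 'm) module_scheme)"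
  shows vs_abelian_group: "abelian_group V"
    and vs_smult_closed: "\<And>c x. x \<in> carrier V \<Longrightarrow> c \<odot>\<^bsub>V\<^esub> x \<in> carrier V"
    and vs_add_smult: "\<And>c d x. x \<in> carrier V \<Longrightarrow>
      (c + d) \<odot>\<^bsub>V\<^esub> x = c \<odot>\<^bsub>V\<^esub> x \<oplus>\<^bsub>V\<^esub> d \<odot>\<^bsub>V\<^esub> x"
    and vs_smult_one: "\<And>x. x \<in> carrier V \<Longrightarrow> 1 \<odot>\<^bsub>V\<^esub> x = x"
proof -
  interpret V: Module.module "base_field :: ('k, 'k) module" V
    using assms by (simp add: vector_space_record_def)
  show "abelian_group V" by (rule V.abelian_group_axioms)
  show "c \<odot>\<^bsub>V\<^esub> x \<in> carrier V" if "x \<in> carrier V" for c x using that by simp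
  show "(c + d) \<odot>\<^bsub>V\<^esub> x = c \<odot>\<^bsub>V\<^esub> x \<oplus>\<^bsub>V\<^esub> d \<odot>\<^bsub>V\<^esub> x" if "x \<in> carrier V" for c d x
    using that V.smult_l_distr[of c d x] by simp
  show "1 \<odot>\<^bsub>V\<^esub> x = x" if "x \<in> carrier V" for x using that V.smult_one[of x] by simp
qed

lemma vs_zero_smult:
  assumes "vector_space_record V" "x \<in> carrier V"
  shows "0 \<odot>\<^bsub>V\<^esub> x = \<zero>\<^bsub>V\<^esub>"
proof -
  interpret V: abelian_group V by (rule vs_abelian_group[OF assms(1)])
  have "0 \<odot>\<^bsub>V\<^esub> x \<oplus>\<^bsub>V\<^esub> 0 \<odot>\<^bsub>V\<^esub> x = 0 \<odot>\<^bsub>V\<^esub> x"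
    using vs_add_smult[OF assms, of 0 0] by simp
  then show ?thesis
    using vs_smult_closed[OF assms, of 0] by simp
qed

lemma vs_add_closed:
  "vector_space_record V \<Longrightarrow> x \<in> carrier V \<Longrightarrow> y \<in> carrier V \<Longrightarrow> x \<oplus>\<^bsub>V\<^esub> y \<in> carrier V"
  using vs_abelian_group abelian_group.axioms(1) abelian_monoid.a_closed by metis

lemma vs_zero_closed: "vector_space_record V \<Longrightarrow> \<zero>\<^bsub>V\<^esub> \<in> carrier V"
  using vs_abelian_group abelian_group.axioms(1) abelian_monoid.zero_closed by metis

lemma vs_finsum_closed:
  "vector_space_record V \<Longrightarrow> (\<And>i. i \<in> K \<Longrightarrow> g i \<in> carrier V) \<Longrightarrow> (\<Oplus>\<^bsub>V\<^esub>i\<in>K. g i) \<in> carrier V"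
  using vs_abelian_group abelian_group.axioms(1) abelian_monoid.finsum_closed
  by (metis Pi_I)

lemma linear_mapsD:
  assumes "f \<in> linear_maps V W"
  shows "\<And>x. x \<in> carrier V \<Longrightarrow> f x \<in> carrier W"
    and "\<And>x y. x \<in> carrier V \<Longrightarrow> y \<in> carrier V \<Longrightarrow> f (x \<oplus>\<^bsub>V\<^esub> y) = f x \<oplus>\<^bsub>W\<^esub> f y"
    and "\<And>c x. x \<in> carrier V \<Longrightarrow> f (c \<odot>\<^bsub>V\<^esub> x) = c \<odot>\<^bsub>W\<^esub> f x"
  using assms by (auto simp: linear_maps_def)

lemma dualI:
  assumes "\<And>x y. x \<in> carrier V \<Longrightarrow> y \<in> carrier V \<Longrightarrow> f (x \<oplus>\<^bsub>V\<^esub> y) = f x + f y"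
    and "\<And>c x. x \<in> carrier V \<Longrightarrow> f (c \<odot>\<^bsub>V\<^esub> x) = c * f x"
  shows "f \<in> dual_space V"
  using assms by (auto simp: linear_maps_def)

lemma
  assumes "f \<in> dual_space V"
  shows dual_add: "\<And>x y. x \<in> carrier V \<Longrightarrow> y \<in> carrier V \<Longrightarrow> f (x \<oplus>\<^bsub>V\<^esub> y) = f x + f y"
    and dual_smult: "\<And>c x. x \<in> carrier V \<Longrightarrow> f (c \<odot>\<^bsub>V\<^esub> x) = c * f x"
  using assms by (auto simp: linear_maps_def)

lemma dual_zero:
  assumes "vector_space_record V" "f \<in> dual_space V"
  shows "f \<zero>\<^bsub>V\<^esub> = 0"
proof -
  have z: "\<zero>\<^bsub>V\<^esub> \<in> carrier V" by (rule vs_zero_closed[OF assms(1)])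
  have "f (0 \<odot>\<^bsub>V\<^esub> \<zero>\<^bsub>V\<^esub>) = 0" using dual_smult[OF assms(2) z, of 0] by simp
  then show ?thesis using vs_zero_smult[OF assms(1) z] by simp
qed

lemma dual_finsum:
  assumes V: "vector_space_record V" and f: "f \<in> dual_space V"
    and "\<And>i. i \<in> K \<Longrightarrow> g i \<in> carrier V" and "finite K"
  shows "f (\<Oplus>\<^bsub>V\<^esub>i\<in>K. g i) = (\<Sum>i\<in>K. f (g i))"
proof -
  interpret V: abelian_group V by (rule vs_abelian_group[OF V])
  show ?thesis
    using assms(4,3)
  proof (induction K rule: finite_induct)
    case empty
    then show ?case using dual_zero[OF V f] by simp
  next
    case (insert i K)
    then have "(\<Oplus>\<^bsub>V\<^esub>i\<in>insert i K. g i) = g i \<oplus>\<^bsub>V\<^esub> (\<Oplus>\<^bsub>V\<^esub>i\<in>K. g i)"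
      by (intro V.finsum_insert) auto
    with insert show ?case
      by (simp add: dual_add[OF f] vs_finsum_closed[OF V])
  qed
qed

lemma dual_lincomb:
  assumes "finite K" "\<And>i. i \<in> K \<Longrightarrow> \<zeta> i \<in> dual_space V"
  shows "(\<lambda>x. \<Sum>i\<in>K. \<zeta> i x * g i) \<in> dual_space V"
  using assms
  by (intro dualI)
    (auto simp: dual_add[of _ V] dual_smult[of _ V] sum.distrib distrib_right sum_distrib_left
      mult.assoc intro!: sum.cong)

text \<open>A basis together with its dual functionals. Separation of points (\<open>eqI\<close>)
  stands in for spanning, which follows from it by duality; this turns equality of vectors into
  equality of scalars.\<close>

locale based_space =
  fixes V :: "('k::field, 'a, 'm) module_scheme"
    and I :: "'i set" and e :: "'i \<Rightarrow> 'a" and \<xi> :: "'i \<Rightarrow> 'a \<Rightarrow> 'k"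
  assumes vs: "vector_space_record V"
    and fin: "finite I"
    and e_closed: "i \<in> I \<Longrightarrow> e i \<in> carrier V"
    and \<xi>_dual: "i \<in> I \<Longrightarrow> \<xi> i \<in> dual_space V"
    and \<xi>_e: "i \<in> I \<Longrightarrow> j \<in> I \<Longrightarrow> \<xi> i (e j) = (if i = j then 1 else 0)"
    and eqI: "v \<in> carrier V \<Longrightarrow> w \<in> carrier V \<Longrightarrow> (\<And>i. i \<in> I \<Longrightarrow> \<xi> i v = \<xi> i w) \<Longrightarrow> v = w"
begin

definition comb :: "('i \<Rightarrow> 'k) \<Rightarrow> 'a" where
  "comb g = (\<Oplus>\<^bsub>V\<^esub>i\<in>I. g i \<odot>\<^bsub>V\<^esub> e i)"

lemma comb_closed: "comb g \<in> carrier V"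
  unfolding comb_def by (intro vs_finsum_closed vs vs_smult_closed e_closed)

lemma dual_comb: "f \<in> dual_space V \<Longrightarrow> f (comb g) = (\<Sum>i\<in>I. g i * f (e i))"
  unfolding comb_def
  by (subst dual_finsum[OF vs]) (auto simp: vs_smult_closed[OF vs] e_closed fin dual_smult[of _ V])

lemma \<xi>_comb: "i \<in> I \<Longrightarrow> \<xi> i (comb g) = g i"
  by (simp add: dual_comb \<xi>_dual \<xi>_e fin if_distrib cong: if_cong)

lemma comb_\<xi>: "v \<in> carrier V \<Longrightarrow> comb (\<lambda>i. \<xi> i v) = v"
  by (rule eqI) (auto simp: comb_closed \<xi>_comb)

lemma dual_expand: "f \<in> dual_space V \<Longrightarrow> v \<in> carrier V \<Longrightarrow> f v = (\<Sum>i\<in>I. \<xi> i v * f (e i))"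
  using dual_comb[of f "\<lambda>i. \<xi> i v"] by (simp add: comb_\<xi>)

lemma finite_dimensional: "finite_dimensional V"
proof -
  \<comment> \<open>The coefficients in \<open>finite_dimensional\<close> are indexed by vectors and
    not by \<open>I\<close>, so the sum has to be reindexed along \<open>e\<close>.\<close>
  have inj: "inj_on e I"
  proof (rule inj_onI)
    fix i j assume "i \<in> I" "j \<in> I" "e i = e j"
    then show "i = j" using \<xi>_e[of i j] \<xi>_e[of i i] by (simp split: if_splits)
  qed
  interpret V: abelian_group V by (rule vs_abelian_group[OF vs])
  have "\<exists>c. v = (\<Oplus>\<^bsub>V\<^esub>b\<in>e ` I. c b \<odot>\<^bsub>V\<^esub> b)" if v: "v \<in> carrier V" for v
  proof
    have "(\<Oplus>\<^bsub>V\<^esub>b\<in>e ` I. \<xi> (inv_into I e b) v \<odot>\<^bsub>V\<^esub> b)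
        = (\<Oplus>\<^bsub>V\<^esub>i\<in>I. \<xi> (inv_into I e (e i)) v \<odot>\<^bsub>V\<^esub> e i)"
      by (intro V.finsum_reindex) (auto simp: vs_smult_closed[OF vs] e_closed inj)
    also have "\<dots> = comb (\<lambda>i. \<xi> i v)"
      unfolding comb_def
      by (intro V.finsum_cong') (auto simp: vs_smult_closed[OF vs] e_closed inj)
    finally show "v = (\<Oplus>\<^bsub>V\<^esub>b\<in>e ` I. \<xi> (inv_into I e b) v \<odot>\<^bsub>V\<^esub> b)"
      by (simp add: comb_\<xi> v)
  qed
  then show ?thesis
    unfolding finite_dimensional_def using fin e_closed
    by (intro exI[of _ "e ` I"]) auto
qed

end


section \<open>Tensor products\<close>

text \<open>Linear extension of \<open>h\<close> to the free vector space. It serves twice: on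
  pairs, for tensors, and on words, for the free algebra.\<close>

definition plift :: "('x \<Rightarrow> 'k::field) \<Rightarrow> ('x \<Rightarrow>\<^sub>0 'k) \<Rightarrow> 'k" where
  "plift h p = (\<Sum>x\<in>Poly_Mapping.keys p. Poly_Mapping.lookup p x * h x)"

abbreviation flift :: "('a \<Rightarrow> 'b \<Rightarrow> 'k::field) \<Rightarrow> ('a \<times> 'b \<Rightarrow>\<^sub>0 'k) \<Rightarrow> 'k" where
  "flift f \<equiv> plift (\<lambda>vw. f (fst vw) (snd vw))"

text \<open>Supports shrink under cancellation, so additivity needs a common finite index set for
  all summands.\<close>

lemma plift_superset:
  assumes "finite K" "Poly_Mapping.keys p \<subseteq> K"
  shows "plift h p = (\<Sum>x\<in>K. Poly_Mapping.lookup p x * h x)"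
  unfolding plift_def using assms
  by (intro sum.mono_neutral_left) (auto simp: in_keys_iff)

lemma lookup_scale [simp]: "Poly_Mapping.lookup (scale c p) x = c * Poly_Mapping.lookup p x"
  by transfer (auto simp: when_def)

lemma keys_scale: "Poly_Mapping.keys (scale c p) \<subseteq> Poly_Mapping.keys p"
  by (auto simp: in_keys_iff)

lemma scale_single: "scale c (Poly_Mapping.single x d) = Poly_Mapping.single x (c * d)"
  by (rule poly_mapping_eqI) (simp add: lookup_single when_def)

lemma scale_add: "scale c (p + p') = scale c p + scale c p'"
  by (rule poly_mapping_eqI) (simp add: lookup_add algebra_simps)

lemma scale_diff: "scale c (p - p') = scale c p - scale c p'"
  by (rule poly_mapping_eqI) (simp add: lookup_minus algebra_simps)

lemma scale_minus_one: "scale (- 1) p = - p"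
  by (rule poly_mapping_eqI) simp

lemma scale_sum: "scale c (sum g K) = (\<Sum>x\<in>K. scale c (g x))"
  by (rule poly_mapping_eqI) (simp add: lookup_sum sum_distrib_left)

lemma poly_mapping_eq_sum_single:
  "p = (\<Sum>x\<in>Poly_Mapping.keys p. Poly_Mapping.single x (Poly_Mapping.lookup p x))"
  by (rule poly_mapping_eqI)
    (auto simp: lookup_sum lookup_single when_def in_keys_iff)

lemma plift_zero [simp]: "plift h 0 = 0"
  by (simp add: plift_def)

lemma plift_add: "plift h (p + p') = plift h p + plift h p'"
proof -
  let ?K = "Poly_Mapping.keys p \<union> Poly_Mapping.keys p'"
  have "Poly_Mapping.keys (p + p') \<subseteq> ?K" by (rule keys_add)
  then show ?thesis
    by (simp add: plift_superset[of ?K] lookup_add distrib_right sum.distrib)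
qed

lemma plift_scale: "plift h (scale c p) = c * plift h p"
  by (subst plift_superset[OF _ keys_scale])
    (auto simp: plift_def sum_distrib_left mult.assoc)

lemma plift_diff: "plift h (p - p') = plift h p - plift h p'"
  using plift_add[of h p "- p'"] plift_scale[of h "-1" p'] by (simp add: scale_minus_one)

lemma plift_single [simp]: "plift h (Poly_Mapping.single x c) = c * h x"
  by (subst plift_superset[of "{x}"]) auto

lemma plift_sum: "plift h (sum g K) = (\<Sum>x\<in>K. plift h (g x))"
  by (induction K rule: infinite_finite_induct) (auto simp: plift_add)

section \<open>Bilinear forms and the relations of the tensor product\<close>

definition bilinear_form ::
  "('k::field, 'a, 'm) module_scheme \<Rightarrow> ('k, 'b, 'l) module_scheme \<Rightarrow> ('a \<Rightarrow> 'b \<Rightarrow> 'k) \<Rightarrow> bool" where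
  "bilinear_form V W f \<longleftrightarrow>
     (\<forall>w\<in>carrier W. (\<lambda>v. f v w) \<in> dual_space V) \<and> (\<forall>v\<in>carrier V. f v \<in> dual_space W)"

lemma bilinear_formI:
  assumes "\<And>w. w \<in> carrier W \<Longrightarrow> (\<lambda>v. f v w) \<in> dual_space V"
    and "\<And>v. v \<in> carrier V \<Longrightarrow> (\<lambda>w. f v w) \<in> dual_space W"
  shows "bilinear_form V W f"
  using assms by (auto simp: bilinear_form_def)

lemma bilinear_form_prod:
  assumes "f \<in> dual_space V" "g \<in> dual_space W"
  shows "bilinear_form V W (\<lambda>v w. f v * g w)"
  using assms
  by (auto intro!: bilinear_formI dualI simp: dual_add[of _ V] dual_smult[of _ V]
      dual_add[of _ W] dual_smult[of _ W] algebra_simps)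

text \<open>Each generating relation is an instance of bilinearity. This is the well-definedness of
  every functional on a tensor product used below.\<close>

lemma flift_tensor_null:
  assumes f: "bilinear_form V W f" and "p \<in> tensor_null V W"
  shows "flift f p = 0"
  using assms(2)
proof induction
  case (add_left v v' w)
  then have "(\<lambda>v. f v w) \<in> dual_space V" using f by (simp add: bilinear_form_def)
  from dual_add[OF this] show ?case using add_left by (simp add: plift_diff)
next
  case (add_right v w w')
  then have "f v \<in> dual_space W" using f by (simp add: bilinear_form_def)
  from dual_add[OF this] show ?case using add_right by (simp add: plift_diff)
next
  case (smult_left v w c)
  then have "(\<lambda>v. f v w) \<in> dual_space V" using f by (simp add: bilinear_form_def)
  from dual_smult[OF this] show ?case using smult_left by (simp add: plift_diff)
next
  case (smult_right v w c)
  then have "f v \<in> dual_space W" using f by (simp add: bilinear_form_def)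
  from dual_smult[OF this] show ?case using smult_right by (simp add: plift_diff)
qed (simp_all add: plift_add plift_scale)

lemma tensor_null_minus: "p \<in> tensor_null V W \<Longrightarrow> - p \<in> tensor_null V W"
  using tensor_null.scale[of p V W "-1"] by (simp add: scale_minus_one)

lemma tensor_null_diff:
  "p \<in> tensor_null V W \<Longrightarrow> p' \<in> tensor_null V W \<Longrightarrow> p - p' \<in> tensor_null V W"
  using tensor_null.add[of p V W "- p'"] tensor_null_minus[of p' V W] by simp

lemma tensor_null_sum:
  "(\<And>x. x \<in> K \<Longrightarrow> g x \<in> tensor_null V W) \<Longrightarrow> sum g K \<in> tensor_null V W"
  by (induction K rule: infinite_finite_induct) (auto intro: tensor_null.zero tensor_null.add)

lemma tensor_class_eq_iff:
  "tensor_class V W p = tensor_class V W p' \<longleftrightarrow> p - p' \<in> tensor_null V W"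
proof
  assume "tensor_class V W p = tensor_class V W p'"
  moreover have "p \<in> tensor_class V W p"
    by (simp add: tensor_class_def tensor_null.zero)
  ultimately show "p - p' \<in> tensor_null V W" by (simp add: tensor_class_def)
next
  assume d: "p - p' \<in> tensor_null V W"
  show "tensor_class V W p = tensor_class V W p'"
    unfolding tensor_class_def
  proof (intro Collect_cong iffI)
    fix x
    show "x - p' \<in> tensor_null V W" if "x - p \<in> tensor_null V W"
      using tensor_null.add[OF that d] by simp
    show "x - p \<in> tensor_null V W" if "x - p' \<in> tensor_null V W"
      using tensor_null_diff[OF that d] by simp
  qed
qed

lemma mem_tensor_class: "p \<in> tensor_class V W p"
  by (simp add: tensor_class_def tensor_null.zero)

lemma mem_tensor_class_iff: "x \<in> tensor_class V W p \<longleftrightarrow> x - p \<in> tensor_null V W"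
  by (simp add: tensor_class_def)

lemma tensor_class_memD: "x \<in> tensor_class V W p \<Longrightarrow> tensor_class V W x = tensor_class V W p"
  by (simp add: tensor_class_eq_iff mem_tensor_class_iff)

lemma tensor_prod_zero [simp]: "\<zero>\<^bsub>tensor_prod V W\<^esub> = tensor_class V W 0"
  by (simp add: tensor_prod_def)

text \<open>All representatives contribute the same class, and a union of copies of one class over
  nonempty index sets is that class.\<close>

lemma tensor_prod_add:
  "tensor_class V W p \<oplus>\<^bsub>tensor_prod V W\<^esub> tensor_class V W p' = tensor_class V W (p + p')"
proof -
  have "tensor_class V W (x + x') = tensor_class V W (p + p')"
    if "x \<in> tensor_class V W p" "x' \<in> tensor_class V W p'" for x x'
    using tensor_null.add[of "x - p" V W "x' - p'"] that
    by (simp add: tensor_class_eq_iff mem_tensor_class_iff algebra_simps)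
  then have "(\<Union>x\<in>tensor_class V W p. \<Union>x'\<in>tensor_class V W p'. tensor_class V W (x + x'))
      = (\<Union>x\<in>tensor_class V W p. \<Union>x'\<in>tensor_class V W p'. tensor_class V W (p + p'))"
    by (intro SUP_cong refl)
  also have "\<dots> = tensor_class V W (p + p')"
    using mem_tensor_class[of p V W] mem_tensor_class[of p' V W] by blast
  finally show ?thesis by (simp add: tensor_prod_def)
qed

lemma tensor_prod_smult:
  "c \<odot>\<^bsub>tensor_prod V W\<^esub> tensor_class V W p = tensor_class V W (scale c p)"
proof -
  have "tensor_class V W (scale c x) = tensor_class V W (scale c p)"
    if "x \<in> tensor_class V W p" for x
    using tensor_null.scale[of "x - p" V W c] that
    by (simp add: tensor_class_eq_iff mem_tensor_class_iff scale_diff)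
  then have "(\<Union>x\<in>tensor_class V W p. tensor_class V W (scale c x))
      = (\<Union>x\<in>tensor_class V W p. tensor_class V W (scale c p))"
    by (intro SUP_cong refl)
  also have "\<dots> = tensor_class V W (scale c p)"
    using mem_tensor_class[of p V W] by blast
  finally show ?thesis by (simp add: tensor_prod_def)
qed

lemma carrier_tensor_prod:
  "carrier (tensor_prod V W) =
     tensor_class V W ` {p. Poly_Mapping.keys p \<subseteq> carrier V \<times> carrier W}"
  by (simp add: tensor_prod_def)

lemma tensor_class_closed:
  "Poly_Mapping.keys p \<subseteq> carrier V \<times> carrier W \<Longrightarrow> tensor_class V W p \<in> carrier (tensor_prod V W)"
  by (auto simp: carrier_tensor_prod)

lemma tensor_prod_cases:
  assumes "X \<in> carrier (tensor_prod V W)"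
  obtains p where "X = tensor_class V W p" "Poly_Mapping.keys p \<subseteq> carrier V \<times> carrier W"
  using assms by (auto simp: carrier_tensor_prod)

lemma pure_tensor_closed:
  "v \<in> carrier V \<Longrightarrow> w \<in> carrier W \<Longrightarrow> pure_tensor V W v w \<in> carrier (tensor_prod V W)"
  unfolding pure_tensor_def by (rule tensor_class_closed) simp

lemma vector_space_record_tensor_prod: "vector_space_record (tensor_prod V W)"
proof (rule vector_space_recordI)
  let ?T = "tensor_prod V W"
  show "abelian_group ?T"
  proof (rule abelian_groupI)
    fix X Y Z assume X: "X \<in> carrier ?T" and Y: "Y \<in> carrier ?T"
    from X obtain p where p: "X = tensor_class V W p" "Poly_Mapping.keys p \<subseteq> carrier V \<times> carrier W"
      by (rule tensor_prod_cases)
    from Y obtain r where r: "Y = tensor_class V W r" "Poly_Mapping.keys r \<subseteq> carrier V \<times> carrier W"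
      by (rule tensor_prod_cases)
    show "X \<oplus>\<^bsub>?T\<^esub> Y \<in> carrier ?T"
      using p r keys_add[of p r] by (auto simp: tensor_prod_add intro!: tensor_class_closed)
    show "X \<oplus>\<^bsub>?T\<^esub> Y = Y \<oplus>\<^bsub>?T\<^esub> X"
      by (simp add: p r tensor_prod_add add.commute)
    show "\<zero>\<^bsub>?T\<^esub> \<oplus>\<^bsub>?T\<^esub> X = X"
      by (simp add: p tensor_prod_add)
    show "\<exists>y\<in>carrier ?T. y \<oplus>\<^bsub>?T\<^esub> X = \<zero>\<^bsub>?T\<^esub>"
      using p by (intro bexI[of _ "tensor_class V W (- p)"])
        (auto simp: tensor_prod_add intro!: tensor_class_closed)
    assume Z: "Z \<in> carrier ?T"
    then obtain s where s: "Z = tensor_class V W s" by (rule tensor_prod_cases)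
    show "(X \<oplus>\<^bsub>?T\<^esub> Y) \<oplus>\<^bsub>?T\<^esub> Z = X \<oplus>\<^bsub>?T\<^esub> (Y \<oplus>\<^bsub>?T\<^esub> Z)"
      by (simp add: p r s tensor_prod_add add.assoc)
  qed (auto intro: tensor_class_closed)
  fix c d X Y assume X: "X \<in> carrier ?T"
  then obtain p where p: "X = tensor_class V W p" "Poly_Mapping.keys p \<subseteq> carrier V \<times> carrier W"
    by (rule tensor_prod_cases)
  show "c \<odot>\<^bsub>?T\<^esub> X \<in> carrier ?T"
    using p keys_scale[of c p] by (auto simp: tensor_prod_smult intro!: tensor_class_closed)
  show "(c + d) \<odot>\<^bsub>?T\<^esub> X = c \<odot>\<^bsub>?T\<^esub> X \<oplus>\<^bsub>?T\<^esub> d \<odot>\<^bsub>?T\<^esub> X"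
    unfolding p tensor_prod_smult tensor_prod_add
    by (rule arg_cong[of _ _ "tensor_class V W"], rule poly_mapping_eqI)
      (simp add: lookup_add algebra_simps)
  show "(c * d) \<odot>\<^bsub>?T\<^esub> X = c \<odot>\<^bsub>?T\<^esub> (d \<odot>\<^bsub>?T\<^esub> X)"
    unfolding p tensor_prod_smult
    by (rule arg_cong[of _ _ "tensor_class V W"], rule poly_mapping_eqI) simp
  show "1 \<odot>\<^bsub>?T\<^esub> X = X"
    unfolding p tensor_prod_smult
    by (rule arg_cong[of _ _ "tensor_class V W"], rule poly_mapping_eqI) simp
  assume Y: "Y \<in> carrier ?T"
  then obtain r where r: "Y = tensor_class V W r" by (rule tensor_prod_cases)
  show "c \<odot>\<^bsub>?T\<^esub> (X \<oplus>\<^bsub>?T\<^esub> Y) = c \<odot>\<^bsub>?T\<^esub> X \<oplus>\<^bsub>?T\<^esub> c \<odot>\<^bsub>?T\<^esub> Y"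
    by (simp add: p r tensor_prod_add tensor_prod_smult scale_add)
qed

section \<open>Functionals on the tensor product\<close>

definition tfun :: "('a \<Rightarrow> 'b \<Rightarrow> 'k::field) \<Rightarrow> ('a \<times> 'b \<Rightarrow>\<^sub>0 'k) set \<Rightarrow> 'k" where
  "tfun f X = flift f (SOME p. p \<in> X)"

lemma tfun_class:
  assumes "bilinear_form V W f"
  shows "tfun f (tensor_class V W p) = flift f p"
proof -
  have "(SOME x. x \<in> tensor_class V W p) \<in> tensor_class V W p"
    by (rule someI[of _ p]) (rule mem_tensor_class)
  then have "flift f ((SOME x. x \<in> tensor_class V W p) - p) = 0"
    by (intro flift_tensor_null[OF assms]) (simp add: mem_tensor_class_iff)
  then show ?thesis by (simp add: tfun_def plift_diff)
qed

lemma tfun_pure: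
  "bilinear_form V W f \<Longrightarrow> tfun f (pure_tensor V W v w) = f v w"
  by (simp add: pure_tensor_def tfun_class)

lemma tfun_dual:
  assumes "bilinear_form V W f"
  shows "tfun f \<in> dual_space (tensor_prod V W)"
proof (rule dualI)
  fix X Y c assume X: "X \<in> carrier (tensor_prod V W)"
  then obtain p where p: "X = tensor_class V W p" by (rule tensor_prod_cases)
  show "tfun f (c \<odot>\<^bsub>tensor_prod V W\<^esub> X) = c * tfun f X"
    by (simp add: p tensor_prod_smult tfun_class[OF assms] plift_scale)
  assume "Y \<in> carrier (tensor_prod V W)"
  then obtain r where r: "Y = tensor_class V W r" by (rule tensor_prod_cases)
  show "tfun f (X \<oplus>\<^bsub>tensor_prod V W\<^esub> Y) = tfun f X + tfun f Y"
    by (simp add: p r tensor_prod_add tfun_class[OF assms] plift_add)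
qed

text \<open>The choice of a representative ranges over whole cosets. Since the relations only
  involve vectors of the carriers, no representative of an element of the carrier leaves
  them.\<close>

lemma keys_tensor_null:
  assumes "vector_space_record V" "vector_space_record W" "p \<in> tensor_null V W"
  shows "Poly_Mapping.keys p \<subseteq> carrier V \<times> carrier W"
  using assms(3)
proof induction
  case (add p p')
  then show ?case using keys_add[of p p'] by blast
next
  case (scale p c)
  then show ?case using keys_scale[of c p] by blast
qed (auto simp: in_keys_iff lookup_minus lookup_single when_def vs_add_closed[OF assms(1)]
      vs_add_closed[OF assms(2)] vs_smult_closed[OF assms(1)] vs_smult_closed[OF assms(2)]
      split: if_splits)

lemma keys_tensor_class:
  assumes "vector_space_record V" "vector_space_record W"
    and "Poly_Mapping.keys p \<subseteq> carrier V \<times> carrier W" "x \<in> tensor_class V W p"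
  shows "Poly_Mapping.keys x \<subseteq> carrier V \<times> carrier W"
  using keys_tensor_null[OF assms(1,2), of "x - p"] keys_add[of "x - p" p] assms(3,4)
  by (auto simp: mem_tensor_class_iff)

lemma some_rep:
  assumes "vector_space_record V" "vector_space_record W" "X \<in> carrier (tensor_prod V W)"
  shows "Poly_Mapping.keys (SOME p. p \<in> X) \<subseteq> carrier V \<times> carrier W"
proof -
  obtain p where p: "X = tensor_class V W p" "Poly_Mapping.keys p \<subseteq> carrier V \<times> carrier W"
    using assms(3) by (rule tensor_prod_cases)
  have "(SOME x. x \<in> X) \<in> X"
    by (rule someI[of _ p]) (simp add: p mem_tensor_class)
  then show ?thesis using keys_tensor_class[OF assms(1,2) p(2)] p(1) by auto
qed

lemma tensor_lift_closed:
  assumes "vector_space_record V" "vector_space_record W" "vector_space_record U"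
    and "X \<in> carrier (tensor_prod V W)"
    and "\<And>v w. v \<in> carrier V \<Longrightarrow> w \<in> carrier W \<Longrightarrow> \<beta> v w \<in> carrier U"
  shows "tensor_lift U \<beta> X \<in> carrier U"
proof -
  have "\<beta> (fst x) (snd x) \<in> carrier U" if "x \<in> Poly_Mapping.keys (SOME p. p \<in> X)" for x
    using some_rep[OF assms(1,2,4)] that assms(5) by (metis SigmaE fst_conv snd_conv subsetD)
  then show ?thesis
    unfolding tensor_lift_def Let_def by (intro vs_finsum_closed vs_smult_closed assms(3))
qed

text \<open>\<open>tfun\<close> and \<open>tensor_lift\<close> choose the same representative, so
  this is linearity of \<open>\<zeta>\<close> over one finite sum.\<close>

lemma dual_tensor_lift:
  assumes "vector_space_record V" "vector_space_record W" "vector_space_record U"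
    and "X \<in> carrier (tensor_prod V W)"
    and "\<And>v w. v \<in> carrier V \<Longrightarrow> w \<in> carrier W \<Longrightarrow> \<beta> v w \<in> carrier U"
    and "\<zeta> \<in> dual_space U"
  shows "\<zeta> (tensor_lift U \<beta> X) = tfun (\<lambda>v w. \<zeta> (\<beta> v w)) X"
proof -
  have *: "\<beta> (fst x) (snd x) \<in> carrier U" if "x \<in> Poly_Mapping.keys (SOME p. p \<in> X)" for x
    using some_rep[OF assms(1,2,4)] that assms(5) by (metis SigmaE fst_conv snd_conv subsetD)
  then show ?thesis
    unfolding tensor_lift_def Let_def tfun_def plift_def
    by (subst dual_finsum[OF assms(3,6)])
      (auto simp: * vs_smult_closed[OF assms(3)] dual_smult[OF assms(6)])
qed

lemma tfun_cong:
  assumes "vector_space_record V" "vector_space_record W" "X \<in> carrier (tensor_prod V W)"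
    and "\<And>v w. v \<in> carrier V \<Longrightarrow> w \<in> carrier W \<Longrightarrow> f v w = g v w"
  shows "tfun f X = tfun g X"
proof -
  have "f (fst x) (snd x) = g (fst x) (snd x)" if "x \<in> Poly_Mapping.keys (SOME p. p \<in> X)" for x
  proof -
    have "x \<in> carrier V \<times> carrier W" using some_rep[OF assms(1-3)] that by blast
    then show ?thesis by (intro assms(4)) auto
  qed
  then show ?thesis unfolding tfun_def plift_def by (intro sum.cong) auto
qed

section \<open>Bases of tensor products\<close>

lemma null_single_smult_left:
  assumes "v \<in> carrier V" "w \<in> carrier W"
  shows "Poly_Mapping.single (d \<odot>\<^bsub>V\<^esub> v, w) c - Poly_Mapping.single (v, w) (c * d) \<in> tensor_null V W"
  using tensor_null.scale[OF tensor_null.smult_left[OF assms, of d], of c]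
  by (simp add: scale_diff scale_single)

lemma null_single_smult_right:
  assumes "v \<in> carrier V" "w \<in> carrier W"
  shows "Poly_Mapping.single (v, d \<odot>\<^bsub>W\<^esub> w) c - Poly_Mapping.single (v, w) (c * d) \<in> tensor_null V W"
  using tensor_null.scale[OF tensor_null.smult_right[OF assms, of d], of c]
  by (simp add: scale_diff scale_single)

lemma null_single_finsum_left:
  assumes V: "vector_space_record V" and w: "w \<in> carrier W"
    and "finite K" "\<And>i. i \<in> K \<Longrightarrow> g i \<in> carrier V"
  shows "Poly_Mapping.single (\<Oplus>\<^bsub>V\<^esub>i\<in>K. g i, w) c - (\<Sum>i\<in>K. Poly_Mapping.single (g i, w) c)
    \<in> tensor_null V W"
  using assms(3,4)
proof (induction K rule: finite_induct)
  case empty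
  interpret V: abelian_group V by (rule vs_abelian_group[OF V])
  show ?case
    \<comment> \<open>The empty sum is the zero vector scaled by 0, so the scalar relation covers
      it.\<close>
    using null_single_smult_left[OF vs_zero_closed[OF V] w, of 0 c]
    by (simp add: vs_zero_smult[OF V])
next
  case (insert i K)
  interpret V: abelian_group V by (rule vs_abelian_group[OF V])
  let ?s = "\<Oplus>\<^bsub>V\<^esub>i\<in>K. g i"
  have s: "?s \<in> carrier V" using insert by (intro vs_finsum_closed V) auto
  have g: "g i \<in> carrier V" using insert by auto
  have "scale c (Poly_Mapping.single (g i \<oplus>\<^bsub>V\<^esub> ?s, w) 1 - Poly_Mapping.single (g i, w) 1
      - Poly_Mapping.single (?s, w) 1) \<in> tensor_null V W"
    by (intro tensor_null.scale tensor_null.add_left g s w)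
  then have "Poly_Mapping.single (g i \<oplus>\<^bsub>V\<^esub> ?s, w) c - Poly_Mapping.single (g i, w) c
      - Poly_Mapping.single (?s, w) c \<in> tensor_null V W"
    by (simp add: scale_diff scale_single)
  moreover have "Poly_Mapping.single (?s, w) c - (\<Sum>i\<in>K. Poly_Mapping.single (g i, w) c)
      \<in> tensor_null V W"
    using insert by auto
  ultimately have "(Poly_Mapping.single (g i \<oplus>\<^bsub>V\<^esub> ?s, w) c - Poly_Mapping.single (g i, w) c
      - Poly_Mapping.single (?s, w) c)
      + (Poly_Mapping.single (?s, w) c - (\<Sum>i\<in>K. Poly_Mapping.single (g i, w) c))
      \<in> tensor_null V W"
    by (rule tensor_null.add)
  moreover have "(\<Oplus>\<^bsub>V\<^esub>i\<in>insert i K. g i) = g i \<oplus>\<^bsub>V\<^esub> ?s"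
    using insert by (intro V.finsum_insert) auto
  ultimately show ?case
    using insert by (simp add: algebra_simps)
qed

lemma null_single_finsum_right:
  assumes W: "vector_space_record W" and v: "v \<in> carrier V"
    and "finite K" "\<And>i. i \<in> K \<Longrightarrow> g i \<in> carrier W"
  shows "Poly_Mapping.single (v, \<Oplus>\<^bsub>W\<^esub>i\<in>K. g i) c - (\<Sum>i\<in>K. Poly_Mapping.single (v, g i) c)
    \<in> tensor_null V W"
  using assms(3,4)
proof (induction K rule: finite_induct)
  case empty
  interpret W: abelian_group W by (rule vs_abelian_group[OF W])
  show ?case
    using null_single_smult_right[OF v vs_zero_closed[OF W], of 0 c]
    by (simp add: vs_zero_smult[OF W])
next
  case (insert i K)
  interpret W: abelian_group W by (rule vs_abelian_group[OF W])
  let ?s = "\<Oplus>\<^bsub>W\<^esub>i\<in>K. g i"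
  have s: "?s \<in> carrier W" using insert by (intro vs_finsum_closed W) auto
  have g: "g i \<in> carrier W" using insert by auto
  have "scale c (Poly_Mapping.single (v, g i \<oplus>\<^bsub>W\<^esub> ?s) 1 - Poly_Mapping.single (v, g i) 1
      - Poly_Mapping.single (v, ?s) 1) \<in> tensor_null V W"
    by (intro tensor_null.scale tensor_null.add_right g s v)
  then have "Poly_Mapping.single (v, g i \<oplus>\<^bsub>W\<^esub> ?s) c - Poly_Mapping.single (v, g i) c
      - Poly_Mapping.single (v, ?s) c \<in> tensor_null V W"
    by (simp add: scale_diff scale_single)
  moreover have "Poly_Mapping.single (v, ?s) c - (\<Sum>i\<in>K. Poly_Mapping.single (v, g i) c)
      \<in> tensor_null V W"
    using insert by auto
  ultimately have "(Poly_Mapping.single (v, g i \<oplus>\<^bsub>W\<^esub> ?s) c - Poly_Mapping.single (v, g i) c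
      - Poly_Mapping.single (v, ?s) c)
      + (Poly_Mapping.single (v, ?s) c - (\<Sum>i\<in>K. Poly_Mapping.single (v, g i) c))
      \<in> tensor_null V W"
    by (rule tensor_null.add)
  moreover have "(\<Oplus>\<^bsub>W\<^esub>i\<in>insert i K. g i) = g i \<oplus>\<^bsub>W\<^esub> ?s"
    using insert by (intro W.finsum_insert) auto
  ultimately show ?case
    using insert by (simp add: algebra_simps)
qed

lemma (in based_space) null_single_left:
  assumes "v \<in> carrier V" "w \<in> carrier W"
  shows "Poly_Mapping.single (v, w) c - (\<Sum>i\<in>I. Poly_Mapping.single (e i, w) (c * \<xi> i v))
    \<in> tensor_null V W"
proof -
  have "(Poly_Mapping.single (comb (\<lambda>i. \<xi> i v), w) c
        - (\<Sum>i\<in>I. Poly_Mapping.single (\<xi> i v \<odot>\<^bsub>V\<^esub> e i, w) c))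
      + (\<Sum>i\<in>I. Poly_Mapping.single (\<xi> i v \<odot>\<^bsub>V\<^esub> e i, w) c
          - Poly_Mapping.single (e i, w) (c * \<xi> i v)) \<in> tensor_null V W"
    unfolding comb_def
    by (intro tensor_null.add tensor_null_sum null_single_finsum_left null_single_smult_left
        vs fin vs_smult_closed e_closed assms)
  then show ?thesis by (simp add: comb_\<xi> assms sum_subtractf)
qed

lemma (in based_space) null_single_right:
  assumes "w \<in> carrier W" "v \<in> carrier V"
  shows "Poly_Mapping.single (w, v) c - (\<Sum>i\<in>I. Poly_Mapping.single (w, e i) (c * \<xi> i v))
    \<in> tensor_null W V"
proof -
  have "(Poly_Mapping.single (w, comb (\<lambda>i. \<xi> i v)) c
        - (\<Sum>i\<in>I. Poly_Mapping.single (w, \<xi> i v \<odot>\<^bsub>V\<^esub> e i) c))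
      + (\<Sum>i\<in>I. Poly_Mapping.single (w, \<xi> i v \<odot>\<^bsub>V\<^esub> e i) c
          - Poly_Mapping.single (w, e i) (c * \<xi> i v)) \<in> tensor_null W V"
    unfolding comb_def
    by (intro tensor_null.add tensor_null_sum null_single_finsum_right null_single_smult_right
        vs fin vs_smult_closed e_closed assms)
  then show ?thesis by (simp add: comb_\<xi> assms sum_subtractf)
qed

text \<open>Expanding both factors shows that products of basis vectors span; the products of dual
  functionals are well defined on cosets and give independence. Applied twice, this yields
  coordinates on the triple tensor product.\<close>

lemma based_space_tensor_prod:
  assumes "based_space V I e \<xi>" "based_space W J f \<eta>"
  shows "based_space (tensor_prod V W) (I \<times> J) (\<lambda>(i, j). pure_tensor V W (e i) (f j))
    (\<lambda>(i, j). tfun (\<lambda>v w. \<xi> i v * \<eta> j w))"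
proof -
  interpret V: based_space V I e \<xi> by (rule assms)
  interpret W: based_space W J f \<eta> by (rule assms)
  let ?\<beta> = "\<lambda>i j v w. \<xi> i v * \<eta> j w"
  have bil: "bilinear_form V W (?\<beta> i j)" if "i \<in> I" "j \<in> J" for i j
    using that by (intro bilinear_form_prod V.\<xi>_dual W.\<xi>_dual)
  \<comment> \<open>A coset is determined by its coordinates, which is the separation property
    demanded by the locale.\<close>
  have normal: "tensor_class V W p =
      tensor_class V W (\<Sum>i\<in>I. \<Sum>j\<in>J. Poly_Mapping.single (e i, f j) (flift (?\<beta> i j) p))"
    if p: "Poly_Mapping.keys p \<subseteq> carrier V \<times> carrier W" for p
  proof -
    let ?l = "Poly_Mapping.lookup p"
    have single: "Poly_Mapping.single (v, w) c
        - (\<Sum>i\<in>I. \<Sum>j\<in>J. Poly_Mapping.single (e i, f j) (c * (\<xi> i v * \<eta> j w))) \<in> tensor_null V W"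
      if "v \<in> carrier V" "w \<in> carrier W" for v w c
    proof -
      have "(Poly_Mapping.single (v, w) c - (\<Sum>i\<in>I. Poly_Mapping.single (e i, w) (c * \<xi> i v)))
        + (\<Sum>i\<in>I. Poly_Mapping.single (e i, w) (c * \<xi> i v)
          - (\<Sum>j\<in>J. Poly_Mapping.single (e i, f j) (c * \<xi> i v * \<eta> j w))) \<in> tensor_null V W"
        by (intro tensor_null.add tensor_null_sum V.null_single_left W.null_single_right
            V.e_closed that)
      then show ?thesis by (simp add: sum_subtractf mult.assoc)
    qed
    have "(\<Sum>x\<in>Poly_Mapping.keys p. Poly_Mapping.single (fst x, snd x) (?l x)
        - (\<Sum>i\<in>I. \<Sum>j\<in>J. Poly_Mapping.single (e i, f j) (?l x * (\<xi> i (fst x) * \<eta> j (snd x)))))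
        \<in> tensor_null V W"
      using p by (intro tensor_null_sum single) auto
    moreover have "(\<Sum>x\<in>Poly_Mapping.keys p. \<Sum>i\<in>I. \<Sum>j\<in>J.
          Poly_Mapping.single (e i, f j) (?l x * (\<xi> i (fst x) * \<eta> j (snd x))))
        = (\<Sum>i\<in>I. \<Sum>j\<in>J. Poly_Mapping.single (e i, f j) (flift (?\<beta> i j) p))"
    proof -
      have "Poly_Mapping.single (e i, f j) (flift (?\<beta> i j) p) = (\<Sum>x\<in>Poly_Mapping.keys p.
          Poly_Mapping.single (e i, f j) (?l x * (\<xi> i (fst x) * \<eta> j (snd x))))" for i j
        by (rule poly_mapping_eqI)
          (simp add: plift_def lookup_sum lookup_single when_def)
      then show ?thesis
        by (simp add: sum.swap[of _ "Poly_Mapping.keys p"])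
    qed
    ultimately show ?thesis
      using poly_mapping_eq_sum_single[of p]
      by (simp add: tensor_class_eq_iff sum_subtractf)
  qed
  show ?thesis
  proof
    fix X Y
    assume X: "X \<in> carrier (tensor_prod V W)" and Y: "Y \<in> carrier (tensor_prod V W)"
      and eq: "\<And>ij. ij \<in> I \<times> J \<Longrightarrow> (case ij of (i, j) \<Rightarrow> tfun (?\<beta> i j)) X
        = (case ij of (i, j) \<Rightarrow> tfun (?\<beta> i j)) Y"
    from X obtain p where p: "X = tensor_class V W p" "Poly_Mapping.keys p \<subseteq> carrier V \<times> carrier W"
      by (rule tensor_prod_cases)
    from Y obtain r where r: "Y = tensor_class V W r" "Poly_Mapping.keys r \<subseteq> carrier V \<times> carrier W"
      by (rule tensor_prod_cases)
    have "flift (?\<beta> i j) p = flift (?\<beta> i j) r" if "i \<in> I" "j \<in> J" for i j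
      using eq[of "(i, j)"] that by (simp add: p r tfun_class[OF bil])
    then show "X = Y"
      unfolding p r normal[OF p(2)] normal[OF r(2)] by simp
  qed (auto simp: V.fin W.fin V.\<xi>_e W.\<xi>_e vector_space_record_tensor_prod tfun_pure[OF bil]
      split: if_splits intro!: pure_tensor_closed V.e_closed W.e_closed tfun_dual bil)
qed

section \<open>Algebras with a monomial basis\<close>

lemma finite_submultisets: "finite {M. M \<subseteq># R}"
proof (rule finite_subset)
  show "{M. M \<subseteq># R} \<subseteq> (\<Union>k\<le>size R. multisets_of_size (set_mset R) k)"
    by (auto simp: multisets_of_size_def size_mset_mono dest: mset_subset_eqD)
qed auto

lemma sum_submultisets_complement:
  "(\<Sum>M | M \<subseteq># R. g (R - M)) = (\<Sum>M | M \<subseteq># R. g M)"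
  by (rule sum.reindex_bij_witness[of _ "\<lambda>M. R - M" "\<lambda>M. R - M"])
    (auto simp: subset_mset.diff_diff_right)

text \<open>
  The basis vector \<open>e M\<close> is the ordered monomial with exponent multiset \<open>M\<close>; \<open>T\<close> is the exponent
  of the socle, and the sign \<open>\<kappa> M N\<close> arises from reordering \<open>e M \<otimes> e N\<close>.
\<close>

locale monomial_algebra = based_space A "{M. M \<subseteq># T}" e \<xi>
  for A :: "('k::field, 'a, 'm) module_scheme" and T :: "'i multiset"
    and e :: "'i multiset \<Rightarrow> 'a" and \<xi> :: "'i multiset \<Rightarrow> 'a \<Rightarrow> 'k" +
  fixes \<kappa> :: "'i multiset \<Rightarrow> 'i multiset \<Rightarrow> 'k"
  assumes alg: "assoc_algebra A"
    and one_eq: "\<one>\<^bsub>A\<^esub> = e {#}"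
    and \<xi>_mult: "x \<in> carrier A \<Longrightarrow> y \<in> carrier A \<Longrightarrow> R \<subseteq># T \<Longrightarrow>
      \<xi> R (x \<otimes>\<^bsub>A\<^esub> y) = (\<Sum>M | M \<subseteq># R. \<kappa> M (R - M) * \<xi> M x * \<xi> (R - M) y)"
    and \<kappa>_add_left: "\<kappa> (M + M') N = \<kappa> M N * \<kappa> M' N"
    and \<kappa>_add_right: "\<kappa> M (N + N') = \<kappa> M N * \<kappa> M N'"
    and \<kappa>_square: "\<kappa> M N * \<kappa> M N = 1"
    and \<kappa>_self: "\<kappa> {#i#} {#i#} = 1"
    and T_nonempty: "T \<noteq> {#}"
begin

lemma \<kappa>_nonzero: "\<kappa> M N \<noteq> 0"
  using \<kappa>_square[of M N] by auto

lemma \<kappa>_empty [simp]: "\<kappa> {#} N = 1" "\<kappa> M {#} = 1"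
  using \<kappa>_add_left[of "{#}" "{#}" N] \<kappa>_add_right[of M "{#}" "{#}"]
    \<kappa>_nonzero[of "{#}" N] \<kappa>_nonzero[of M "{#}"] by auto

lemma e_cl: "M \<subseteq># T \<Longrightarrow> e M \<in> carrier A"
  by (rule e_closed) simp

lemma \<xi>_d: "M \<subseteq># T \<Longrightarrow> \<xi> M \<in> dual_space A"
  by (rule \<xi>_dual) simp

lemma \<xi>_eq: "M \<subseteq># T \<Longrightarrow> N \<subseteq># T \<Longrightarrow> \<xi> M (e N) = (if M = N then 1 else 0)"
  by (rule \<xi>_e) simp_all

lemma ring_A: "ring A"
  using alg by (simp add: assoc_algebra_def)

lemma mult_closed: "x \<in> carrier A \<Longrightarrow> y \<in> carrier A \<Longrightarrow> x \<otimes>\<^bsub>A\<^esub> y \<in> carrier A"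
  using ring_A by (rule ring.ring_simprules(5))

lemma one_closed: "\<one>\<^bsub>A\<^esub> \<in> carrier A"
  using ring_A by (rule ring.ring_simprules(6))

lemma mult_dual:
  assumes "f \<in> dual_space A" "y \<in> carrier A"
  shows "(\<lambda>x. f (x \<otimes>\<^bsub>A\<^esub> y)) \<in> dual_space A"
  using alg assms ring.ring_simprules(13)[OF ring_A]
  by (auto intro!: dualI simp: dual_add[of _ A] dual_smult[of _ A] mult_closed assoc_algebra_def)

lemma tensor2: "based_space (tensor_prod A A) ({M. M \<subseteq># T} \<times> {M. M \<subseteq># T})
    (\<lambda>(i, j). pure_tensor A A (e i) (e j)) (\<lambda>(i, j). tfun (\<lambda>v w. \<xi> i v * \<xi> j w))"
  by (rule based_space_tensor_prod) (rule based_space_axioms)+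

lemma tensor3: "based_space (tensor_prod A (tensor_prod A A))
    ({M. M \<subseteq># T} \<times> ({M. M \<subseteq># T} \<times> {M. M \<subseteq># T}))
    (\<lambda>(i, j). pure_tensor A (tensor_prod A A) (e i)
      ((\<lambda>(i, j). pure_tensor A A (e i) (e j)) j))
    (\<lambda>(i, j). tfun (\<lambda>v w. \<xi> i v * (\<lambda>(i, j). tfun (\<lambda>v w. \<xi> i v * \<xi> j w)) j w))"
  by (rule based_space_tensor_prod) (rule based_space_axioms tensor2)+

lemma bil: "M \<subseteq># T \<Longrightarrow> N \<subseteq># T \<Longrightarrow> bilinear_form A A (\<lambda>v w. \<xi> M v * \<xi> N w)"
  by (intro bilinear_form_prod \<xi>_dual) auto

lemma tensor2_eqI:
  assumes "X \<in> carrier (tensor_prod A A)" "Y \<in> carrier (tensor_prod A A)"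
    and "\<And>P Q. P \<subseteq># T \<Longrightarrow> Q \<subseteq># T \<Longrightarrow>
      tfun (\<lambda>v w. \<xi> P v * \<xi> Q w) X = tfun (\<lambda>v w. \<xi> P v * \<xi> Q w) Y"
  shows "X = Y"
  by (rule based_space.eqI[OF tensor2]) (use assms in auto)

lemma tensor3_eqI:
  assumes "X \<in> carrier (tensor_prod A (tensor_prod A A))"
    and "Y \<in> carrier (tensor_prod A (tensor_prod A A))"
    and "\<And>P Q R. P \<subseteq># T \<Longrightarrow> Q \<subseteq># T \<Longrightarrow> R \<subseteq># T \<Longrightarrow>
      tfun (\<lambda>v w. \<xi> P v * tfun (\<lambda>v w. \<xi> Q v * \<xi> R w) w) X =
      tfun (\<lambda>v w. \<xi> P v * tfun (\<lambda>v w. \<xi> Q v * \<xi> R w) w) Y"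
  shows "X = Y"
  by (rule based_space.eqI[OF tensor3]) (use assms in auto)

end


section \<open>The bi-Frobenius structure\<close>

text \<open>\<open>c M\<close> is to be the eigenvalue of the antipode on \<open>e M\<close>.
  Reversing products demands \<open>c_add\<close>; reversing the comultiplication of
  \<open>e T\<close> demands \<open>c_square\<close> and \<open>c_T\<close>.\<close>

locale bi_frobenius_data = monomial_algebra A T e \<xi> \<kappa>
  for A :: "('k::field, 'a, 'm) module_scheme" and T :: "'i multiset"
    and e \<xi> and \<kappa> :: "'i multiset \<Rightarrow> 'i multiset \<Rightarrow> 'k" +
  fixes c :: "'i multiset \<Rightarrow> 'k"
  assumes c_empty: "c {#} = 1" and c_T: "c T = 1"
    and c_add: "c (M + N) = \<kappa> M N * \<kappa> N M * c M * c N"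
    and c_square: "M \<subseteq># T \<Longrightarrow> c M * c M = \<kappa> M (T - M) * \<kappa> (T - M) M"
begin

lemma c_nonzero: "M \<subseteq># T \<Longrightarrow> c M \<noteq> 0"
  using c_square[of M] \<kappa>_nonzero by auto

text \<open>The antipode built from \<open>\<Delta> (e T)\<close> multiplies \<open>e Q\<close> by
  \<open>b Q * \<kappa> (T - Q) Q\<close>. Since the sign is its own inverse, this is the choice
  that makes the eigenvalue \<open>c Q\<close>.\<close>

definition b :: "'i multiset \<Rightarrow> 'k" where
  "b Q = \<kappa> (T - Q) Q * c Q"

lemma b_simps [simp]: "b {#} = 1" "b T = 1"
  by (simp_all add: b_def c_empty c_T)

lemma b_nonzero: "Q \<subseteq># T \<Longrightarrow> b Q \<noteq> 0"
  by (simp add: b_def \<kappa>_nonzero c_nonzero)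

text \<open>The symmetry by which \<open>S\<close> reverses \<open>\<Delta> (e T)\<close>; here
  \<open>c_square\<close> compares the two orders of a complementary pair.\<close>

lemma b_sym: "P + Q = T \<Longrightarrow> b Q = c P * c Q * b P"
proof -
  assume T: "P + Q = T"
  then have "P \<subseteq># T" "T - P = Q" "T - Q = P" by auto
  with c_square[of P] have "c P * c Q * b P = (\<kappa> Q P * \<kappa> Q P) * (\<kappa> P Q * c Q)"
    by (simp add: b_def mult_ac)
  also have "\<dots> = b Q"
    by (simp add: \<kappa>_square b_def \<open>T - Q = P\<close>)
  finally show ?thesis by (rule sym)
qed

text \<open>
  The structure constants of \<open>\<Delta>\<close>: every \<open>e M\<close> with \<open>M \<noteq> {#}, T\<close> is primitive, and
  \<open>\<Delta> (e T) = \<Sum>\<^sub>Q b Q (e (T - Q) \<otimes> e Q)\<close>.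
\<close>

definition D :: "'a \<Rightarrow> 'i multiset \<Rightarrow> 'i multiset \<Rightarrow> 'k" where
  "D a P Q = (if P = {#} then \<xi> Q a else if Q = {#} then \<xi> P a
     else if P + Q = T then b Q * \<xi> T a else 0)"

definition \<Delta> :: "'a \<Rightarrow> ('a \<times> 'a \<Rightarrow>\<^sub>0 'k) set" where
  "\<Delta> a = tensor_class A A
     (\<Sum>P | P \<subseteq># T. \<Sum>Q | Q \<subseteq># T. Poly_Mapping.single (e P, e Q) (D a P Q))"

lemma D_empty [simp]: "D a {#} Q = \<xi> Q a" "D a P {#} = \<xi> P a"
  by (auto simp: D_def)

lemma D_dual: "P \<subseteq># T \<Longrightarrow> Q \<subseteq># T \<Longrightarrow> (\<lambda>a. D a P Q) \<in> dual_space A"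
  by (rule dualI)
    (auto simp: D_def dual_add[OF \<xi>_d] dual_smult[OF \<xi>_d] algebra_simps)

text \<open>The two terms forced by the counit fit the general pattern because \<open>b {#}\<close>
  and \<open>b T\<close> are both 1.\<close>

lemma D_T: "P \<subseteq># T \<Longrightarrow> Q \<subseteq># T \<Longrightarrow> D (e T) P Q = (if P = T - Q then b Q else 0)"
  by (auto simp: D_def \<xi>_eq T_nonempty dest: subset_mset.add_diff_inverse)

lemma \<Delta>_closed: "\<Delta> a \<in> carrier (tensor_prod A A)"
  unfolding \<Delta>_def
proof (rule tensor_class_closed)
  show "Poly_Mapping.keys (\<Sum>P | P \<subseteq># T. \<Sum>Q | Q \<subseteq># T. Poly_Mapping.single (e P, e Q) (D a P Q))
    \<subseteq> carrier A \<times> carrier A"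
    by (auto simp: in_keys_iff lookup_sum lookup_single when_def e_cl
        elim!: sum.not_neutral_contains_not_neutral split: if_splits)
qed

lemma tfun_\<Delta>:
  assumes "bilinear_form A A f"
  shows "tfun f (\<Delta> a) = (\<Sum>P | P \<subseteq># T. \<Sum>Q | Q \<subseteq># T. D a P Q * f (e P) (e Q))"
  unfolding \<Delta>_def tfun_class[OF assms] plift_sum by simp

lemma \<xi>_sum_left: "M \<subseteq># T \<Longrightarrow> (\<Sum>P | P \<subseteq># T. g P * \<xi> M (e P)) = g M"
  by (simp add: \<xi>_eq finite_submultisets if_distrib cong: if_cong)

lemma \<xi>_sum_right: "M \<subseteq># T \<Longrightarrow> (\<Sum>N | N \<subseteq># T. \<xi> N (e M) * g N) = g M"
  by (simp add: \<xi>_eq finite_submultisets if_distrib[of "\<lambda>z. z * _"] cong: if_cong)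

lemma coord_\<Delta>:
  assumes "P \<subseteq># T" "Q \<subseteq># T"
  shows "tfun (\<lambda>v w. \<xi> P v * \<xi> Q w) (\<Delta> a) = D a P Q"
  using assms
  by (simp add: tfun_\<Delta>[OF bil] \<xi>_sum_left flip: mult.assoc)

lemma \<Delta>_linear: "\<Delta> \<in> linear_maps A (tensor_prod A A)"
proof -
  have "\<Delta> (x \<oplus>\<^bsub>A\<^esub> y) = \<Delta> x \<oplus>\<^bsub>tensor_prod A A\<^esub> \<Delta> y" if "x \<in> carrier A" "y \<in> carrier A" for x y
    by (rule tensor2_eqI)
      (auto simp: dual_add[OF tfun_dual[OF bil]] \<Delta>_closed coord_\<Delta> dual_add[OF D_dual] that
        intro!: vs_add_closed vector_space_record_tensor_prod)
  moreover have "\<Delta> (r \<odot>\<^bsub>A\<^esub> x) = r \<odot>\<^bsub>tensor_prod A A\<^esub> \<Delta> x" if "x \<in> carrier A" for r x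
    by (rule tensor2_eqI)
      (auto simp: dual_smult[OF tfun_dual[OF bil]] \<Delta>_closed coord_\<Delta> dual_smult[OF D_dual] that
        intro!: vs_smult_closed vector_space_record_tensor_prod)
  ultimately show ?thesis by (simp add: linear_maps_def \<Delta>_closed)
qed

text \<open>If one index is empty, both sides collapse to a single structure constant. Otherwise
  both vanish: a constant of \<open>e N\<close> with two nonempty indices forces
  \<open>N = T\<close>, while \<open>T\<close> paired with a nonempty index never sums to
  \<open>T\<close>.\<close>

lemma D_coassoc:
  assumes a: "a \<in> carrier A" and PQR: "P \<subseteq># T" "Q \<subseteq># T" "R \<subseteq># T"
  shows "(\<Sum>N | N \<subseteq># T. D a P N * D (e N) Q R) = (\<Sum>N | N \<subseteq># T. D a N R * D (e N) P Q)"
proof -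
  have expand: "(\<Sum>N | N \<subseteq># T. \<xi> N a * D (e N) M M') = D a M M'"
    if "M \<subseteq># T" "M' \<subseteq># T" for M M'
    using dual_expand[OF D_dual[OF that] a] by simp
  have off: "D a P T = 0" "D a T R = 0" if "P \<noteq> {#}" "R \<noteq> {#}"
    using that T_nonempty by (auto simp: D_def)
  consider "P = {#}" | "Q = {#}" | "R = {#}" | "P \<noteq> {#}" "Q \<noteq> {#}" "R \<noteq> {#}" by blast
  then show ?thesis
  proof cases
    case 4
    have "D a P N * D (e N) Q R = 0" if "N \<subseteq># T" for N
      using that 4 off by (cases "N = T") (auto simp: D_def[of "e N"] \<xi>_eq)
    moreover have "D a N R * D (e N) P Q = 0" if "N \<subseteq># T" for N
      using that 4 off by (cases "N = T") (auto simp: D_def[of "e N"] \<xi>_eq)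
    ultimately show ?thesis by (simp add: sum.neutral)
  qed (simp_all add: \<xi>_sum_left expand PQR)
qed

lemma coalgebra_\<Delta>: "coalgebra A \<Delta> (\<xi> {#})"
  unfolding coalgebra_def Let_def
proof (intro conjI ballI)
  let ?AA = "tensor_prod A A"
  let ?A3 = "tensor_prod A ?AA"
  note vs2 = vector_space_record_tensor_prod[of A A]
  note vs3 = vector_space_record_tensor_prod[of A ?AA]
  show "vector_space_record A" by (rule vs)
  show "\<Delta> \<in> linear_maps A ?AA" by (rule \<Delta>_linear)
  show "\<xi> {#} \<in> dual_space A" by (rule \<xi>_d) simp
  fix a assume a: "a \<in> carrier A"
  show "tensor_lift A (\<lambda>a1 a2. \<xi> {#} a1 \<odot>\<^bsub>A\<^esub> a2) (\<Delta> a) = a"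
    by (rule eqI)
      (auto simp: a \<Delta>_closed dual_tensor_lift[OF vs vs vs _ _ \<xi>_d] vs_smult_closed[OF vs]
        dual_smult[OF \<xi>_d] coord_\<Delta>
        intro!: tensor_lift_closed[OF vs vs vs] cong: tfun_cong[OF vs vs])
  show "tensor_lift A (\<lambda>a1 a2. \<xi> {#} a2 \<odot>\<^bsub>A\<^esub> a1) (\<Delta> a) = a"
    by (rule eqI)
      (auto simp: a \<Delta>_closed dual_tensor_lift[OF vs vs vs _ _ \<xi>_d] vs_smult_closed[OF vs]
        dual_smult[OF \<xi>_d] coord_\<Delta> mult.commute[of "\<xi> {#} _"]
        intro!: tensor_lift_closed[OF vs vs vs] cong: tfun_cong[OF vs vs])
  show "tensor_lift ?A3 (\<lambda>a1 a2. pure_tensor A ?AA a1 (\<Delta> a2)) (\<Delta> a) =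
    tensor_lift ?A3 (\<lambda>a1 a2. tensor_lift ?A3
      (\<lambda>a11 a12. pure_tensor A ?AA a11 (pure_tensor A A a12 a2)) (\<Delta> a1)) (\<Delta> a)"
    (is "tensor_lift ?A3 ?f (\<Delta> a) = tensor_lift ?A3 ?g (\<Delta> a)")
  proof (rule tensor3_eqI)
    have f: "?f v w \<in> carrier ?A3" if "v \<in> carrier A" "w \<in> carrier A" for v w
      using that by (intro pure_tensor_closed \<Delta>_closed)
    have g': "pure_tensor A ?AA v (pure_tensor A A w x) \<in> carrier ?A3"
      if "v \<in> carrier A" "w \<in> carrier A" "x \<in> carrier A" for v w x
      using that by (intro pure_tensor_closed)
    have g: "?g v w \<in> carrier ?A3" if "v \<in> carrier A" "w \<in> carrier A" for v w
      using that by (intro tensor_lift_closed[OF vs vs vs3] \<Delta>_closed g')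
    show "tensor_lift ?A3 ?f (\<Delta> a) \<in> carrier ?A3"
      by (intro tensor_lift_closed[OF vs vs vs3] \<Delta>_closed f)
    show "tensor_lift ?A3 ?g (\<Delta> a) \<in> carrier ?A3"
      by (intro tensor_lift_closed[OF vs vs vs3] \<Delta>_closed g)
    fix P Q R assume PQR: "P \<subseteq># T" "Q \<subseteq># T" "R \<subseteq># T"
    let ?\<zeta>2 = "tfun (\<lambda>v w. \<xi> Q v * \<xi> R w)"
    let ?\<zeta> = "tfun (\<lambda>v w. \<xi> P v * ?\<zeta>2 w)"
    have bil3: "bilinear_form A ?AA (\<lambda>v w. \<xi> P v * ?\<zeta>2 w)"
      using PQR by (intro bilinear_form_prod \<xi>_d tfun_dual bil)
    have \<zeta>: "?\<zeta> \<in> dual_space ?A3" by (rule tfun_dual[OF bil3])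
    have "?\<zeta> (tensor_lift ?A3 ?f (\<Delta> a)) = tfun (\<lambda>v w. ?\<zeta> (?f v w)) (\<Delta> a)"
      by (rule dual_tensor_lift[OF vs vs vs3 \<Delta>_closed f \<zeta>])
    also have "\<dots> = tfun (\<lambda>v w. \<xi> P v * D w Q R) (\<Delta> a)"
      using PQR by (simp add: tfun_pure[OF bil3] coord_\<Delta>)
    also have "\<dots> = (\<Sum>M | M \<subseteq># T. \<Sum>N | N \<subseteq># T. D a M N * (\<xi> P (e M) * D (e N) Q R))"
      using PQR by (intro tfun_\<Delta> bilinear_form_prod \<xi>_d D_dual)
    also have "\<dots> = (\<Sum>N | N \<subseteq># T. \<Sum>M | M \<subseteq># T. (D a M N * D (e N) Q R) * \<xi> P (e M))"
      by (subst sum.swap) (simp add: mult_ac)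
    also have "\<dots> = (\<Sum>N | N \<subseteq># T. D a P N * D (e N) Q R)"
      by (intro sum.cong refl \<xi>_sum_left PQR)
    also have "\<dots> = (\<Sum>N | N \<subseteq># T. D a N R * D (e N) P Q)"
      by (rule D_coassoc[OF a PQR])
    also have "\<dots> = (\<Sum>M | M \<subseteq># T. \<Sum>N | N \<subseteq># T. (D a M N * D (e M) P Q) * \<xi> R (e N))"
      by (intro sum.cong refl \<xi>_sum_left[symmetric] PQR)
    also have "\<dots> = (\<Sum>M | M \<subseteq># T. \<Sum>N | N \<subseteq># T. D a M N * (D (e M) P Q * \<xi> R (e N)))"
      by (simp add: mult_ac)
    also have "\<dots> = tfun (\<lambda>v w. D v P Q * \<xi> R w) (\<Delta> a)"
      using PQR by (intro tfun_\<Delta>[symmetric] bilinear_form_prod \<xi>_d D_dual)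
    \<comment> \<open>In the nested lift \<open>w\<close> is fixed while the inner sum runs over
      \<open>\<Delta> v\<close>, so \<open>\<xi> R w\<close> factors out as a scalar.\<close>
    also have "\<dots> = tfun (\<lambda>v w. ?\<zeta> (?g v w)) (\<Delta> a)"
    proof (rule tfun_cong[OF vs vs \<Delta>_closed])
      fix v w assume vw: "v \<in> carrier A" "w \<in> carrier A"
      have "?\<zeta> (?g v w) = tfun (\<lambda>x y. ?\<zeta> (pure_tensor A ?AA x (pure_tensor A A y w))) (\<Delta> v)"
        by (rule dual_tensor_lift[OF vs vs vs3 \<Delta>_closed _ \<zeta>]) (rule g', use vw in auto)
      also have "\<dots> = tfun (\<lambda>x y. \<xi> P x * (\<xi> R w * \<xi> Q y)) (\<Delta> v)"
        using PQR by (simp add: tfun_pure[OF bil3] tfun_pure[OF bil] mult_ac)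
      also have "\<dots> = (\<Sum>M | M \<subseteq># T. \<Sum>N | N \<subseteq># T. D v M N * (\<xi> P (e M) * (\<xi> R w * \<xi> Q (e N))))"
        using PQR by (intro tfun_\<Delta> bilinear_formI dualI)
          (auto simp: dual_add[OF \<xi>_d] dual_smult[OF \<xi>_d] algebra_simps)
      also have "\<dots> = \<xi> R w * tfun (\<lambda>x y. \<xi> P x * \<xi> Q y) (\<Delta> v)"
        using PQR by (simp add: tfun_\<Delta>[OF bil] sum_distrib_left mult_ac)
      also have "\<dots> = D v P Q * \<xi> R w"
        using PQR by (simp add: coord_\<Delta>)
      finally show "D v P Q * \<xi> R w = ?\<zeta> (?g v w)" by simp
    qed
    also have "\<dots> = ?\<zeta> (tensor_lift ?A3 ?g (\<Delta> a))"
      by (rule dual_tensor_lift[OF vs vs vs3 \<Delta>_closed g \<zeta>, symmetric])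
    finally show "?\<zeta> (tensor_lift ?A3 ?f (\<Delta> a)) = ?\<zeta> (tensor_lift ?A3 ?g (\<Delta> a))" .
  qed
qed

section \<open>Nondegeneracy of the form and of the comultiplied socle monomial\<close>

lemma frobenius_algebra_\<xi>: "frobenius_algebra A (\<xi> T)"
  unfolding frobenius_algebra_def
proof (intro conjI ballI)
  show "\<xi> T \<in> dual_space A" by (rule \<xi>_d) simp
  fix f assume f: "f \<in> dual_space A"
  \<comment> \<open>The form pairs \<open>e M\<close> only with \<open>e (T - M)\<close>, and by a
    sign. Its matrix is a signed permutation, so the coordinates of \<open>y\<close> can be read
    off.\<close>
  define y where "y = comb (\<lambda>N. \<kappa> (T - N) N * f (e (T - N)))"
  show "\<exists>y\<in>carrier A. \<forall>x\<in>carrier A. f x = \<xi> T (x \<otimes>\<^bsub>A\<^esub> y)"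
  proof (intro bexI ballI)
    show y: "y \<in> carrier A" by (simp add: y_def comb_closed)
    fix x assume x: "x \<in> carrier A"
    have "\<xi> T (x \<otimes>\<^bsub>A\<^esub> y) = (\<Sum>M | M \<subseteq># T. \<kappa> M (T - M) * \<xi> M x * \<xi> (T - M) y)"
      by (rule \<xi>_mult[OF x y]) simp
    also have "\<dots> = (\<Sum>M | M \<subseteq># T. \<xi> M x * f (e M))"
    proof (rule sum.cong[OF refl])
      fix M assume "M \<in> {M. M \<subseteq># T}"
      then have M: "T - (T - M) = M" by (auto simp: subset_mset.diff_diff_right)
      have "\<xi> (T - M) y = \<kappa> M (T - M) * f (e M)"
        unfolding y_def by (subst \<xi>_comb) (auto simp: M)
      then show "\<kappa> M (T - M) * \<xi> M x * \<xi> (T - M) y = \<xi> M x * f (e M)"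
        using \<kappa>_square[of M "T - M"] by simp
    qed
    also have "\<dots> = f x" by (rule dual_expand[OF f x, symmetric])
    finally show "f x = \<xi> T (x \<otimes>\<^bsub>A\<^esub> y)" by (rule sym)
  qed
qed

lemma tfun_\<Delta>_T:
  assumes "f \<in> dual_space A" "Q \<subseteq># T"
  shows "tfun (\<lambda>v w. f v * \<xi> Q w) (\<Delta> (e T)) = b Q * f (e (T - Q))"
proof -
  have "tfun (\<lambda>v w. f v * \<xi> Q w) (\<Delta> (e T))
      = (\<Sum>P | P \<subseteq># T. \<Sum>R | R \<subseteq># T. D (e T) P R * f (e P) * \<xi> Q (e R))"
    using assms by (simp add: tfun_\<Delta> bilinear_form_prod \<xi>_d mult.assoc)
  also have "\<dots> = (\<Sum>P | P \<subseteq># T. if P = T - Q then b Q * f (e P) else 0)"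
    using assms(2) by (intro sum.cong refl) (auto simp: \<xi>_sum_left D_T)
  also have "\<dots> = b Q * f (e (T - Q))"
    by (simp add: finite_submultisets)
  finally show ?thesis .
qed

lemma frobenius_coalgebra_e: "frobenius_coalgebra A \<Delta> (e T)"
  unfolding frobenius_coalgebra_def
proof (intro conjI ballI)
  show "e T \<in> carrier A" by (rule e_cl) simp
  fix x assume x: "x \<in> carrier A"
  \<comment> \<open>The functional is solved for coordinatewise: \<open>\<Delta> (e T)\<close> links
    \<open>T - Q\<close> to \<open>Q\<close> alone, with the nonzero factor
    \<open>b Q\<close>.\<close>
  define f where "f y = (\<Sum>M | M \<subseteq># T. \<xi> M y * (\<xi> (T - M) x / b (T - M)))" for y
  have f: "f \<in> dual_space A"
    unfolding f_def by (intro dual_lincomb finite_submultisets \<xi>_d) simp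
  have fe: "f (e M) = \<xi> (T - M) x / b (T - M)" if "M \<subseteq># T" for M
    unfolding f_def by (rule \<xi>_sum_right[OF that])
  show "\<exists>f\<in>dual_space A. x = tensor_lift A (\<lambda>t1 t2. f t1 \<odot>\<^bsub>A\<^esub> t2) (\<Delta> (e T))"
  proof (intro bexI eqI x)
    show "f \<in> dual_space A" by (rule f)
    show "tensor_lift A (\<lambda>t1 t2. f t1 \<odot>\<^bsub>A\<^esub> t2) (\<Delta> (e T)) \<in> carrier A"
      by (intro tensor_lift_closed[OF vs vs vs] \<Delta>_closed vs_smult_closed[OF vs])
    fix Q assume "Q \<in> {M. M \<subseteq># T}"
    then have Q: "Q \<subseteq># T" "T - (T - Q) = Q" by (auto simp: subset_mset.diff_diff_right)
    have "\<xi> Q (tensor_lift A (\<lambda>t1 t2. f t1 \<odot>\<^bsub>A\<^esub> t2) (\<Delta> (e T)))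
        = tfun (\<lambda>v w. \<xi> Q (f v \<odot>\<^bsub>A\<^esub> w)) (\<Delta> (e T))"
      by (intro dual_tensor_lift[OF vs vs vs] \<Delta>_closed vs_smult_closed[OF vs] \<xi>_d Q)
    also have "\<dots> = tfun (\<lambda>v w. f v * \<xi> Q w) (\<Delta> (e T))"
      by (intro tfun_cong[OF vs vs] \<Delta>_closed dual_smult[OF \<xi>_d] Q)
    also have "\<dots> = \<xi> Q x"
      using Q b_nonzero[of Q] by (simp add: tfun_\<Delta>_T[OF f] fe)
    finally show "\<xi> Q x = \<xi> Q (tensor_lift A (\<lambda>t1 t2. f t1 \<odot>\<^bsub>A\<^esub> t2) (\<Delta> (e T)))" by simp
  qed
qed

section \<open>The antipode\<close>

definition S :: "'a \<Rightarrow> 'a" where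
  "S a = tensor_lift A (\<lambda>t1 t2. \<xi> T (t1 \<otimes>\<^bsub>A\<^esub> a) \<odot>\<^bsub>A\<^esub> t2) (\<Delta> (e T))"

lemma S_closed: "a \<in> carrier A \<Longrightarrow> S a \<in> carrier A"
  unfolding S_def by (intro tensor_lift_closed[OF vs vs vs] \<Delta>_closed vs_smult_closed[OF vs])

text \<open>The antipode is diagonal: the \<open>Q\<close> coordinate meets only the first tensor
  factor \<open>e (T - Q)\<close>, and \<open>\<xi> T\<close> of its product with \<open>a\<close>
  sees only the \<open>Q\<close> coordinate of \<open>a\<close>. The sign in \<open>b Q\<close>
  cancels the one from the product.\<close>

lemma \<xi>_S:
  assumes a: "a \<in> carrier A" and Q: "Q \<subseteq># T"
  shows "\<xi> Q (S a) = c Q * \<xi> Q a"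
proof -
  let ?f = "\<lambda>v. \<xi> T (v \<otimes>\<^bsub>A\<^esub> a)"
  have f: "?f \<in> dual_space A" by (intro mult_dual a \<xi>_d) simp
  have "\<xi> Q (S a) = tfun (\<lambda>v w. \<xi> Q (?f v \<odot>\<^bsub>A\<^esub> w)) (\<Delta> (e T))"
    unfolding S_def by (intro dual_tensor_lift[OF vs vs vs] \<Delta>_closed vs_smult_closed[OF vs] \<xi>_d Q)
  also have "\<dots> = tfun (\<lambda>v w. ?f v * \<xi> Q w) (\<Delta> (e T))"
    by (intro tfun_cong[OF vs vs] \<Delta>_closed dual_smult[OF \<xi>_d] Q)
  also have "\<dots> = b Q * \<xi> T (e (T - Q) \<otimes>\<^bsub>A\<^esub> a)"
    by (rule tfun_\<Delta>_T[OF f Q])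
  also have "\<xi> T (e (T - Q) \<otimes>\<^bsub>A\<^esub> a)
      = (\<Sum>M | M \<subseteq># T. \<kappa> M (T - M) * \<xi> (T - M) a * \<xi> M (e (T - Q)))"
    by (subst \<xi>_mult) (auto simp: a e_cl mult_ac)
  also have "\<dots> = (\<Sum>M | M \<subseteq># T. if M = T - Q then \<kappa> (T - Q) Q * \<xi> Q a else 0)"
    using Q by (intro sum.cong refl) (auto simp: \<xi>_eq subset_mset.diff_diff_right)
  also have "b Q * \<dots> = c Q * \<xi> Q a"
    using \<kappa>_square[of "T - Q" Q] by (simp add: finite_submultisets b_def)
  finally show ?thesis .
qed

lemma S_linear: "S \<in> linear_maps A A"
proof -
  have "S (x \<oplus>\<^bsub>A\<^esub> y) = S x \<oplus>\<^bsub>A\<^esub> S y" if "x \<in> carrier A" "y \<in> carrier A" for x y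
    by (rule eqI)
      (use that in \<open>auto simp: S_closed vs_add_closed[OF vs] \<xi>_S dual_add[OF \<xi>_d] algebra_simps\<close>)
  moreover have "S (r \<odot>\<^bsub>A\<^esub> x) = r \<odot>\<^bsub>A\<^esub> S x" if "x \<in> carrier A" for r x
    by (rule eqI)
      (use that in \<open>auto simp: S_closed vs_smult_closed[OF vs] \<xi>_S dual_smult[OF \<xi>_d]\<close>)
  ultimately show ?thesis by (simp add: linear_maps_def S_closed)
qed

text \<open>In coordinates, exchanging the factors is the complement
  \<open>M \<mapsto> R - M\<close>, and \<open>c_add\<close> supplies the change from one reordering
  sign to the other.\<close>

lemma S_antihom: "S \<in> algebra_antihom A A"
  unfolding algebra_antihom_def
proof (intro CollectI conjI ballI)
  show "S \<in> linear_maps A A" by (rule S_linear)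
  show "S \<one>\<^bsub>A\<^esub> = \<one>\<^bsub>A\<^esub>"
    by (rule eqI) (auto simp: one_closed S_closed \<xi>_S one_eq e_cl \<xi>_eq c_empty)
  fix x y assume x: "x \<in> carrier A" and y: "y \<in> carrier A"
  show "S (x \<otimes>\<^bsub>A\<^esub> y) = S y \<otimes>\<^bsub>A\<^esub> S x"
  proof (rule eqI)
    fix R assume "R \<in> {M. M \<subseteq># T}"
    then have R: "R \<subseteq># T" by simp
    have "\<xi> R (S (x \<otimes>\<^bsub>A\<^esub> y))
        = (\<Sum>M | M \<subseteq># R. c R * (\<kappa> M (R - M) * \<xi> M x * \<xi> (R - M) y))"
      using R by (simp add: \<xi>_S mult_closed x y \<xi>_mult sum_distrib_left)
    also have "\<dots> = (\<Sum>M | M \<subseteq># R. \<kappa> (R - M) (R - (R - M)) * \<xi> (R - M) (S y) * \<xi> (R - (R - M)) (S x))"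
    proof (rule sum.cong[OF refl])
      fix M assume "M \<in> {M. M \<subseteq># R}"
      then have M: "M \<subseteq># R" "R - (R - M) = M" "M + (R - M) = R"
        by (auto simp: subset_mset.diff_diff_right)
      then have MT: "M \<subseteq># T" "R - M \<subseteq># T"
        using R by (meson diff_subset_eq_self subset_mset.order_trans)+
      have "c R = \<kappa> M (R - M) * \<kappa> (R - M) M * c M * c (R - M)"
        using c_add[of M "R - M"] M(3) by simp
      then have "c R * (\<kappa> M (R - M) * \<xi> M x * \<xi> (R - M) y)
          = (\<kappa> M (R - M) * \<kappa> M (R - M)) * (\<kappa> (R - M) M * (c (R - M) * \<xi> (R - M) y) * (c M * \<xi> M x))"
        by (simp add: mult_ac)
      then show "c R * (\<kappa> M (R - M) * \<xi> M x * \<xi> (R - M) y)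
          = \<kappa> (R - M) (R - (R - M)) * \<xi> (R - M) (S y) * \<xi> (R - (R - M)) (S x)"
        by (simp add: M(2) \<xi>_S MT x y \<kappa>_square)
    qed
    also have "\<dots> = (\<Sum>M | M \<subseteq># R. \<kappa> M (R - M) * \<xi> M (S y) * \<xi> (R - M) (S x))"
      by (rule sum_submultisets_complement)
    also have "\<dots> = \<xi> R (S y \<otimes>\<^bsub>A\<^esub> S x)"
      using R by (simp add: \<xi>_mult S_closed x y)
    finally show "\<xi> R (S (x \<otimes>\<^bsub>A\<^esub> y)) = \<xi> R (S y \<otimes>\<^bsub>A\<^esub> S x)" .
  qed (auto intro!: mult_closed S_closed x y)
qed

text \<open>With an empty index this is \<open>c {#} = 1\<close>. With two nonempty indices only
  \<open>P + Q = T\<close> matters, where it is \<open>b_sym\<close> combined with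
  \<open>c T = 1\<close>.\<close>

lemma D_S:
  assumes a: "a \<in> carrier A" and PQ: "P \<subseteq># T" "Q \<subseteq># T"
  shows "D (S a) P Q = c P * c Q * D a Q P"
proof -
  consider "P = {#}" | "Q = {#}" | "P \<noteq> {#}" "Q \<noteq> {#}" by blast
  then show ?thesis
  proof cases
    case 3
    then show ?thesis
      using b_sym[of P Q] by (auto simp: D_def \<xi>_S a c_T add.commute)
  qed (simp_all add: \<xi>_S a PQ c_empty)
qed

lemma S_coalgebra_antihom: "coalgebra_antihom A \<Delta> (\<xi> {#}) S"
  unfolding coalgebra_antihom_def
proof (intro conjI ballI)
  let ?AA = "tensor_prod A A"
  note vs2 = vector_space_record_tensor_prod[of A A]
  show "S \<in> linear_maps A A" by (rule S_linear)
  fix a assume a: "a \<in> carrier A"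
  show "\<xi> {#} (S a) = \<xi> {#} a" by (simp add: \<xi>_S a c_empty)
  show "\<Delta> (S a) = tensor_lift ?AA (\<lambda>a1 a2. pure_tensor A A (S a2) (S a1)) (\<Delta> a)"
    (is "_ = ?R")
  proof (rule tensor2_eqI)
    have cl: "pure_tensor A A (S w) (S v) \<in> carrier ?AA"
      if "v \<in> carrier A" "w \<in> carrier A" for v w
      using that by (intro pure_tensor_closed S_closed)
    show "\<Delta> (S a) \<in> carrier ?AA" by (rule \<Delta>_closed)
    show "?R \<in> carrier ?AA"
      by (intro tensor_lift_closed[OF vs vs vs2] \<Delta>_closed cl)
    fix P Q assume PQ: "P \<subseteq># T" "Q \<subseteq># T"
    let ?\<zeta> = "tfun (\<lambda>v w. \<xi> P v * \<xi> Q w)"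
    have "?\<zeta> ?R = tfun (\<lambda>v w. ?\<zeta> (pure_tensor A A (S w) (S v))) (\<Delta> a)"
      by (rule dual_tensor_lift[OF vs vs vs2 \<Delta>_closed cl tfun_dual[OF bil[OF PQ]]])
    also have "\<dots> = tfun (\<lambda>v w. (c P * c Q * \<xi> Q v) * \<xi> P w) (\<Delta> a)"
      by (rule tfun_cong[OF vs vs \<Delta>_closed])
        (simp add: tfun_pure[OF bil] PQ \<xi>_S mult_ac)
    also have "\<dots> = (\<Sum>M | M \<subseteq># T. \<Sum>N | N \<subseteq># T. D a M N * ((c P * c Q * \<xi> Q (e M)) * \<xi> P (e N)))"
      using PQ by (intro tfun_\<Delta> bilinear_form_prod \<xi>_d dualI)
        (auto simp: dual_add[OF \<xi>_d] dual_smult[OF \<xi>_d] algebra_simps)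
    also have "\<dots> = c P * c Q * tfun (\<lambda>v w. \<xi> Q v * \<xi> P w) (\<Delta> a)"
      unfolding tfun_\<Delta>[OF bil[OF PQ(2) PQ(1)]] sum_distrib_left by (simp add: mult_ac)
    also have "\<dots> = ?\<zeta> (\<Delta> (S a))"
      using PQ by (simp add: coord_\<Delta> D_S a)
    finally show "?\<zeta> (\<Delta> (S a)) = ?\<zeta> ?R" by (rule sym)
  qed
qed

lemma group_like_one: "group_like A \<Delta> (\<xi> {#}) \<one>\<^bsub>A\<^esub>"
  unfolding group_like_def
proof (intro conjI)
  show "\<one>\<^bsub>A\<^esub> \<in> carrier A" by (rule one_closed)
  show "\<xi> {#} \<one>\<^bsub>A\<^esub> = 1" by (simp add: one_eq \<xi>_eq)
  show "\<Delta> \<one>\<^bsub>A\<^esub> = pure_tensor A A \<one>\<^bsub>A\<^esub> \<one>\<^bsub>A\<^esub>"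
  proof (rule tensor2_eqI)
    fix P Q assume "P \<subseteq># T" "Q \<subseteq># T"
    then show "tfun (\<lambda>v w. \<xi> P v * \<xi> Q w) (\<Delta> \<one>\<^bsub>A\<^esub>)
        = tfun (\<lambda>v w. \<xi> P v * \<xi> Q w) (pure_tensor A A \<one>\<^bsub>A\<^esub> \<one>\<^bsub>A\<^esub>)"
      using T_nonempty by (auto simp: coord_\<Delta> tfun_pure[OF bil] one_eq \<xi>_eq D_def)
  qed (auto intro: \<Delta>_closed pure_tensor_closed one_closed)
qed

lemma \<epsilon>_hom: "\<xi> {#} \<in> algebra_hom A base_field"
  unfolding algebra_hom_def
  by (auto intro!: \<xi>_d ring_hom_memI simp: \<xi>_mult one_eq \<xi>_eq dual_add[OF \<xi>_d])

lemma admits_bi_frobenius: "admits_bi_frobenius_algebra A"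
proof -
  have "bi_frobenius_algebra A \<Delta> (\<xi> {#}) (\<xi> T) (e T) S"
    unfolding bi_frobenius_algebra_def
    by (intro conjI ballI alg finite_dimensional coalgebra_\<Delta> S_def \<epsilon>_hom group_like_one
        frobenius_algebra_\<xi> frobenius_coalgebra_e S_antihom S_coalgebra_antihom)
  then show ?thesis unfolding admits_bi_frobenius_algebra_def by blast
qed

end

section \<open>The antipode coefficients\<close>

lemma prod_mset_update_uminus:
  fixes l :: "'i \<Rightarrow> 'k::comm_ring_1"
  shows "(\<Prod>j\<in>#M. (l(i := - l i)) j) = (- 1) ^ count M i * (\<Prod>j\<in>#M. l j)"
  by (induction M) auto

lemma even_multiset_half:
  assumes "\<And>i. even (count T i)"
  obtains U where "T = U + U"
proof
  define U where "U = (\<Sum>i\<in>set_mset T. replicate_mset (count T i div 2) i)"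
  have U: "count U i = count T i div 2" for i
    by (simp add: U_def count_sum not_in_iff if_distrib cong: if_cong)
  show "T = U + U"
  proof (rule multiset_eqI)
    fix i show "count T i = count (U + U) i" using assms[of i] by (auto simp: U)
  qed
qed

text \<open>
  The antipode scales \<open>x\<^sub>i\<close> by \<open>l i\<close>, where \<open>(l i)\<^sup>2\<close> must be the sign picked up by \<open>x\<^sub>i\<close> when it
  commutes with the socle monomial; this is what requires \<open>\<surd>-1\<close>. The remaining condition \<open>c T = 1\<close>
  is met up to sign, and the sign can be flipped at any \<open>i\<close> with odd \<open>count T i\<close>.
\<close>

lemma (in monomial_algebra) bi_frobenius_data_exists:
  assumes s: "s ^ 2 = (- 1 :: 'k)"
  shows "\<exists>c. bi_frobenius_data A T e \<xi> \<kappa> c"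
proof -
  \<comment> \<open>The sign by which \<open>e M\<close> commutes with the socle monomial; it is
    multiplicative in \<open>M\<close>.\<close>
  define \<mu> where "\<mu> M = \<kappa> T M * \<kappa> M T" for M
  define L :: "('i \<Rightarrow> 'k) \<Rightarrow> 'i multiset \<Rightarrow> 'k" where "L l M = (\<Prod>i\<in>#M. l i)" for l M
  \<comment> \<open>\<open>\<kappa> M M\<close> is quadratic in \<open>M\<close>, and its
    polarisation \<open>\<kappa> M N * \<kappa> N M\<close> is the factor by which
    \<open>c_add\<close> deviates from multiplicativity.\<close>
  define c where "c l M = L l M * \<kappa> M M" for l M
  define ok where "ok l \<longleftrightarrow> (\<forall>i. l i * l i = \<mu> {#i#})" for l
  have L_add: "L l (M + N) = L l M * L l N" for l M N by (simp add: L_def)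
  have L_sq: "L l M * L l M = \<mu> M" if "ok l" for l M
  proof (induction M)
    case empty
    then show ?case by (simp add: L_def \<mu>_def)
  next
    case (add i M)
    have "L l (add_mset i M) * L l (add_mset i M) = (l i * l i) * (L l M * L l M)"
      by (simp add: L_def mult_ac)
    also have "\<dots> = \<mu> {#i#} * \<mu> M" using that add by (simp add: ok_def)
    also have "\<dots> = \<mu> (add_mset i M)"
      using \<kappa>_add_right[of T "{#i#}" M] \<kappa>_add_left[of "{#i#}" M T] by (simp add: \<mu>_def mult_ac)
    finally show ?case .
  qed
  have data: "bi_frobenius_data A T e \<xi> \<kappa> (c l)" if l: "ok l" and cT: "c l T = 1" for l
  proof
    show "c l {#} = 1" by (simp add: c_def L_def)
    show "c l T = 1" by (rule cT)
    show "c l (M + N) = \<kappa> M N * \<kappa> N M * c l M * c l N" for M N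
      by (simp add: c_def L_add \<kappa>_add_left \<kappa>_add_right mult_ac)
    fix M assume "M \<subseteq># T"
    then have T: "T = (T - M) + M" by simp
    have "c l M * c l M = \<mu> M * (\<kappa> M M * \<kappa> M M)"
      by (simp add: c_def L_sq[OF l, symmetric] mult_ac)
    \<comment> \<open>Commuting with \<open>T\<close> differs from commuting with the complement
      \<open>T - M\<close> only by \<open>\<kappa> M M\<close> squared, which is 1.\<close>
    also have "\<mu> M = \<kappa> (T - M) M * \<kappa> M (T - M) * (\<kappa> M M * \<kappa> M M)"
      unfolding \<mu>_def by (subst (1 2) T) (simp add: \<kappa>_add_left \<kappa>_add_right mult_ac)
    finally show "c l M * c l M = \<kappa> M (T - M) * \<kappa> (T - M) M"
      by (simp add: \<kappa>_square mult.commute)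
  qed
  define l where "l i = (if \<mu> {#i#} = 1 then 1 else s)" for i
  have "\<mu> {#i#} * \<mu> {#i#} = 1" for i
    using \<kappa>_square[of T "{#i#}"] \<kappa>_square[of "{#i#}" T] by (simp add: \<mu>_def mult_ac)
  then have sign: "\<mu> {#i#} = 1 \<or> \<mu> {#i#} = - 1" for i by (simp add: square_eq_1_iff)
  have l: "ok l"
    unfolding ok_def
  proof
    fix i
    show "l i * l i = \<mu> {#i#}"
      using sign[of i] s by (auto simp: l_def power2_eq_square)
  qed
  \<comment> \<open>As \<open>\<mu> T\<close> is \<open>\<kappa> T T\<close> squared, the square of
    \<open>c l T\<close> is a product of squares of signs; so \<open>c l T\<close> is itself a
    sign.\<close>
  have "c l T * c l T = (\<kappa> T T * \<kappa> T T) * (\<kappa> T T * \<kappa> T T)"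
    using L_sq[OF l, of T] by (simp add: c_def \<mu>_def mult_ac)
  then have "c l T * c l T = 1" by (simp add: \<kappa>_square)
  then consider "c l T = 1" | "c l T = - 1" by (auto simp: square_eq_1_iff)
  then show ?thesis
  proof cases
    case 1
    then show ?thesis using data[OF l] by blast
  next
    case 2
    show ?thesis
    proof (cases "\<forall>i. even (count T i)")
      case True
      then obtain U where U: "T = U + U" using even_multiset_half by blast
      \<comment> \<open>No multiplicity is odd, so no sign can be flipped. But then
        \<open>L l T\<close> is a square, hence free of the chosen roots, and every sign left occurs
        to an even power.\<close>
      have "L l T = \<mu> U" using L_add[of l U U] L_sq[OF l, of U] U by simp
      then have "c l T = \<mu> U * \<kappa> T T" by (simp add: c_def)
      also have "\<dots> = (\<kappa> U U * \<kappa> U U) * (\<kappa> U U * \<kappa> U U) * ((\<kappa> U U * \<kappa> U U) * (\<kappa> U U * \<kappa> U U))"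
        unfolding \<mu>_def U by (simp add: \<kappa>_add_left \<kappa>_add_right mult_ac)
      finally have "c l T = 1" by (simp add: \<kappa>_square)
      then show ?thesis using data[OF l] by blast
    next
      case False
      then obtain i where i: "odd (count T i)" by blast
      let ?l = "l(i := - l i)"
      have "ok ?l" using l by (simp add: ok_def)
      moreover have "c ?l T = 1"
        using 2 i unfolding c_def L_def prod_mset_update_uminus by simp
      ultimately show ?thesis using data by blast
    qed
  qed
qed


section \<open>Non-existence of bialgebra structures\<close>

text \<open>Split off the full power of \<open>p\<close> from \<open>n\<close>, with cofactor
  \<open>b\<close> prime to \<open>p\<close>. If \<open>b > 1\<close>, the binomial coefficient of
  \<open>n\<close> over that power has the same \<open>p\<close>-adic valuation as \<open>b\<close>,
  namely 0, although it vanishes in the field.\<close>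

lemma eq_CHAR_power_if_choose_eq_0:
  assumes "n \<ge> 2" and choose: "\<And>r. 0 < r \<Longrightarrow> r < n \<Longrightarrow> of_nat (n choose r) = (0 :: 'k::field)"
  shows "\<exists>m. n = CHAR('k) ^ m"
proof -
  let ?p = "CHAR('k)"
  have dvd: "?p dvd (n choose r)" if "0 < r" "r < n" for r
    using choose[OF that] by (simp add: of_nat_eq_0_iff_char_dvd)
  \<comment> \<open>The case \<open>r = 1\<close> also excludes characteristic 0, since 0 divides no
    positive number.\<close>
  have "?p dvd n" using dvd[of 1] assms(1) by simp
  then have "?p \<noteq> 0" using assms(1) by (metis dvd_0_left_iff not_numeral_le_zero)
  then have p: "prime ?p" by (intro prime_CHAR_semidom) simp
  obtain b where b: "n = ?p ^ multiplicity ?p n * b" "\<not> ?p dvd b"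
    using multiplicity_decompose'[of n ?p] p assms(1)
    by (metis not_prime_unit not_numeral_le_zero)
  have "b > 0" using b assms(1) by (intro Nat.gr0I) auto
  have "b = 1"
  proof (rule ccontr)
    assume "b \<noteq> 1"
    then have "?p ^ multiplicity ?p n * 1 < ?p ^ multiplicity ?p n * b"
      using \<open>b > 0\<close> \<open>?p \<noteq> 0\<close> by (intro mult_strict_left_mono) auto
    then have "?p dvd (n choose ?p ^ multiplicity ?p n)"
      using \<open>?p \<noteq> 0\<close> b(1) by (intro dvd) auto
    moreover have "multiplicity ?p (n choose ?p ^ multiplicity ?p n) = multiplicity ?p b"
      using const_p_fac[OF \<open>b > 0\<close> p, of "multiplicity ?p n"] b(1) by simp
    moreover have "multiplicity ?p b = 0"
      using b(2) by (rule not_dvd_imp_multiplicity_0)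
    moreover have "n choose ?p ^ multiplicity ?p n > 0"
      using \<open>?p ^ multiplicity ?p n * 1 < _\<close> b(1) by (simp add: zero_less_binomial)
    ultimately show False
      using p by (metis multiplicity_eq_zero_iff not_prime_unit not_gr0)
  qed
  then show ?thesis using b(1) by (intro exI[of _ "multiplicity ?p n"]) simp
qed

text \<open>The lowest-degree part of a product with a series of the form \<open>u + v + \<dots>\<close>.\<close>

lemma convolution_binomial_step:
  fixes c d :: "nat \<Rightarrow> nat \<Rightarrow> 'k::field"
  assumes c: "c 0 0 = 0" "c 1 0 = 1" "c 0 1 = 1"
    and d: "\<And>r' s'. r' \<le> r \<Longrightarrow> s' \<le> s \<Longrightarrow> r' + s' \<le> m \<Longrightarrow>
      d r' s' = (if r' + s' < m then 0 else of_nat (m choose r'))"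
    and rs: "r + s \<le> Suc m"
  shows "(\<Sum>r'\<le>r. \<Sum>s'\<le>s. c r' s' * d (r - r') (s - s'))
    = (if r + s < Suc m then 0 else of_nat (Suc m choose r))"
proof -
  \<comment> \<open>Only the linear terms of the first factor survive: if it takes degree at least
    2, the second is left with degree below \<open>m\<close>.\<close>
  have "c r' s' * d (r - r') (s - s')
      = (if r' = 1 then if s' = 0 then d (r - 1) s else 0 else 0)
        + (if r' = 0 then if s' = 1 then d r (s - 1) else 0 else 0)"
    if "r' \<le> r" "s' \<le> s" for r' s'
  proof -
    consider "r' = 0" "s' = 0" | "r' = 1" "s' = 0" | "r' = 0" "s' = 1" | "r' + s' \<ge> 2"
      by linarith
    then show ?thesis
    proof cases
      case 4
      then have "d (r - r') (s - s') = 0" using that rs by (subst d) auto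
      then show ?thesis using 4 by auto
    qed (use c in auto)
  qed
  then have "(\<Sum>r'\<le>r. \<Sum>s'\<le>s. c r' s' * d (r - r') (s - s'))
      = (\<Sum>r'\<le>r. (if r' = 1 then \<Sum>s'\<le>s. if s' = 0 then d (r - 1) s else 0 else 0)
        + (if r' = 0 then \<Sum>s'\<le>s. if s' = 1 then d r (s - 1) else 0 else 0))"
    by (intro sum.cong refl) (auto simp: sum.distrib)
  also have "\<dots> = (if 1 \<le> r then d (r - 1) s else 0) + (if 1 \<le> s then d r (s - 1) else 0)"
    by (simp add: sum.distrib)
  \<comment> \<open>Pascal's rule, where one of the two summands is missing when \<open>r\<close> or
    \<open>s\<close> is 0.\<close>
  also have "\<dots> = (if r + s < Suc m then 0 else of_nat (Suc m choose r))"
  proof (cases r)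
    case 0
    then show ?thesis using rs by (cases s) (auto simp: d)
  next
    case (Suc r')
    show ?thesis
    proof (cases s)
      case 0
      then show ?thesis using Suc rs by (auto simp: d)
    next
      case (Suc s')
      with \<open>r = Suc r'\<close> show ?thesis using rs by (auto simp: d)
    qed
  qed
  finally show ?thesis .
qed

lemma sum_swap_pairs:
  "(\<Sum>x\<in>A. \<Sum>y\<in>B. \<Sum>r\<in>C. \<Sum>s\<in>D. f x y r s) = (\<Sum>r\<in>C. \<Sum>s\<in>D. \<Sum>x\<in>A. \<Sum>y\<in>B. f x y r s)"
proof -
  have "(\<Sum>x\<in>A. \<Sum>y\<in>B. \<Sum>r\<in>C. \<Sum>s\<in>D. f x y r s) = (\<Sum>x\<in>A. \<Sum>r\<in>C. \<Sum>y\<in>B. \<Sum>s\<in>D. f x y r s)"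
    by (rule sum.cong[OF refl], rule sum.swap)
  also have "\<dots> = (\<Sum>r\<in>C. \<Sum>x\<in>A. \<Sum>s\<in>D. \<Sum>y\<in>B. f x y r s)"
    by (subst sum.swap) (intro sum.cong[OF refl], rule sum.swap)
  also have "\<dots> = (\<Sum>r\<in>C. \<Sum>s\<in>D. \<Sum>x\<in>A. \<Sum>y\<in>B. f x y r s)"
    by (rule sum.cong[OF refl], rule sum.swap)
  finally show ?thesis .
qed

context monomial_algebra
begin

lemma e_mult:
  assumes M: "M \<subseteq># T" and N: "N \<subseteq># T"
  shows "e M \<otimes>\<^bsub>A\<^esub> e N = (if M + N \<subseteq># T then \<kappa> M N \<odot>\<^bsub>A\<^esub> e (M + N) else \<zero>\<^bsub>A\<^esub>)"
proof (rule eqI)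
  show "e M \<otimes>\<^bsub>A\<^esub> e N \<in> carrier A" by (intro mult_closed e_cl M N)
  show "(if M + N \<subseteq># T then \<kappa> M N \<odot>\<^bsub>A\<^esub> e (M + N) else \<zero>\<^bsub>A\<^esub>) \<in> carrier A"
    by (simp add: vs_smult_closed[OF vs] e_cl vs_zero_closed[OF vs])
  fix R assume "R \<in> {M. M \<subseteq># T}"
  then have R: "R \<subseteq># T" by simp
  have "\<xi> R (e M \<otimes>\<^bsub>A\<^esub> e N)
      = (\<Sum>M' | M' \<subseteq># R. if M' = M then if R = M + N then \<kappa> M N else 0 else 0)"
    unfolding \<xi>_mult[OF e_cl[OF M] e_cl[OF N] R]
  proof (rule sum.cong[OF refl])
    fix M' assume "M' \<in> {M. M \<subseteq># R}"
    then have M': "M' \<subseteq># R" "M' \<subseteq># T" "R - M' \<subseteq># T" "R - M' = N \<longleftrightarrow> R = M' + N"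
      using R by (auto intro: subset_mset.order_trans[OF diff_subset_eq_self]
        dest: subset_mset.add_diff_inverse)
    then show "\<kappa> M' (R - M') * \<xi> M' (e M) * \<xi> (R - M') (e N)
        = (if M' = M then if R = M + N then \<kappa> M N else 0 else 0)"
      by (auto simp: \<xi>_eq M N)
  qed
  also have "\<dots> = (if R = M + N then \<kappa> M N else 0)"
    by (auto simp: finite_submultisets)
  also have "\<dots> = \<xi> R (if M + N \<subseteq># T then \<kappa> M N \<odot>\<^bsub>A\<^esub> e (M + N) else \<zero>\<^bsub>A\<^esub>)"
    using R by (auto simp: dual_smult[OF \<xi>_d] e_cl \<xi>_eq dual_zero[OF vs \<xi>_d])
  finally show "\<xi> R (e M \<otimes>\<^bsub>A\<^esub> e N)
      = \<xi> R (if M + N \<subseteq># T then \<kappa> M N \<odot>\<^bsub>A\<^esub> e (M + N) else \<zero>\<^bsub>A\<^esub>)" .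
qed

text \<open>The square of a nonconstant monomial is zero or a multiple of a strictly larger
  monomial. Induction on the distance to the size of \<open>T\<close> thus makes its counit value
  square to zero, and a field has no nilpotents.\<close>

lemma augmentation_unique:
  assumes \<epsilon>: "\<epsilon> \<in> algebra_hom A base_field" and a: "a \<in> carrier A"
  shows "\<epsilon> a = \<xi> {#} a"
proof -
  have d: "\<epsilon> \<in> dual_space A" and hom: "\<epsilon> \<in> ring_hom A base_field"
    using \<epsilon> by (auto simp: algebra_hom_def)
  have zero: "\<epsilon> (e M) = 0" if "M \<subseteq># T" "M \<noteq> {#}" for M
    using that
  proof (induction "size T - size M" arbitrary: M rule: less_induct)
    case less
    have "\<epsilon> (e M) * \<epsilon> (e M) = \<epsilon> (e M \<otimes>\<^bsub>A\<^esub> e M)"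
      using ring_hom_mult[OF hom, of "e M" "e M"] less.prems by (simp add: e_cl)
    also have "\<dots> = 0"
    proof (cases "M + M \<subseteq># T")
      case True
      have "size T - size (M + M) < size T - size M"
        using size_mset_mono[OF True] less.prems by (simp add: nonempty_has_size)
      then have "\<epsilon> (e (M + M)) = 0" using less True by auto
      then show ?thesis using True less.prems by (simp add: e_mult dual_smult[OF d] e_cl)
    next
      case False
      then show ?thesis using less.prems by (simp add: e_mult dual_zero[OF vs d])
    qed
    finally show ?case by simp
  qed
  have one: "\<epsilon> (e {#}) = 1" using ring_hom_one[OF hom] by (simp add: one_eq)
  have "\<epsilon> a = (\<Sum>M | M \<subseteq># T. \<xi> M a * \<epsilon> (e M))" by (rule dual_expand[OF d a])
  also have "\<dots> = (\<Sum>M | M \<subseteq># T. if M = {#} then \<xi> {#} a else 0)"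
    by (intro sum.cong refl) (auto simp: zero one)
  also have "\<dots> = \<xi> {#} a" by (simp add: finite_submultisets)
  finally show ?thesis .
qed

section \<open>Coordinates along the powers of one generator\<close>

definition \<eta> :: "'i \<Rightarrow> nat \<Rightarrow> 'a \<Rightarrow> 'k" where
  "\<eta> i r = \<xi> (replicate_mset r i)"

lemma \<kappa>_replicate: "\<kappa> (replicate_mset r i) (replicate_mset s i) = 1"
proof -
  have *: "\<kappa> {#i#} (replicate_mset s i) = 1"
  proof (induction s)
    case (Suc s)
    then show ?case
      using \<kappa>_add_right[of "{#i#}" "{#i#}" "replicate_mset s i"] by (simp add: \<kappa>_self)
  qed simp
  show ?thesis
  proof (induction r)
    case (Suc r)
    then show ?case
      using \<kappa>_add_left[of "{#i#}" "replicate_mset r i" "replicate_mset s i"] * by simp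
  qed simp
qed

lemma \<eta>_dual: "r \<le> count T i \<Longrightarrow> \<eta> i r \<in> dual_space A"
  unfolding \<eta>_def by (rule \<xi>_d) (simp add: count_le_replicate_mset_subset_eq)

text \<open>Below a power of \<open>x_i\<close> there are only powers of \<open>x_i\<close>, and
  these carry trivial signs. So these coordinates multiply like the coefficients of a polynomial in
  one variable, and the other generators drop out.\<close>

lemma \<eta>_mult:
  assumes "x \<in> carrier A" "y \<in> carrier A" "r \<le> count T i"
  shows "\<eta> i r (x \<otimes>\<^bsub>A\<^esub> y) = (\<Sum>s\<le>r. \<eta> i s x * \<eta> i (r - s) y)"
proof -
  have "\<eta> i r (x \<otimes>\<^bsub>A\<^esub> y) = (\<Sum>M | M \<subseteq># replicate_mset r i.
      \<kappa> M (replicate_mset r i - M) * \<xi> M x * \<xi> (replicate_mset r i - M) y)"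
    unfolding \<eta>_def using assms by (intro \<xi>_mult) (simp add: count_le_replicate_mset_subset_eq)+
  also have "\<dots> = (\<Sum>s\<le>r. \<eta> i s x * \<eta> i (r - s) y)"
  proof (rule sum.reindex_bij_witness[of _ "\<lambda>s. replicate_mset s i" size])
    fix M assume "M \<in> {M. M \<subseteq># replicate_mset r i}"
    then obtain s where s: "s \<le> r" "M = replicate_mset s i"
      by (auto elim: msubseteq_replicate_msetE)
    then show "replicate_mset (size M) i = M" "size M \<in> {..r}" by auto
    have "replicate_mset r i - replicate_mset s i = replicate_mset (r - s) i"
      by (rule multiset_eqI) simp
    then show "\<eta> i (size M) x * \<eta> i (r - size M) y
        = \<kappa> M (replicate_mset r i - M) * \<xi> M x * \<xi> (replicate_mset r i - M) y"
      by (simp add: s \<eta>_def \<kappa>_replicate)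
  qed (auto simp: replicate_mset_msubseteq_iff)
  finally show ?thesis .
qed

definition coef :: "'i \<Rightarrow> nat \<Rightarrow> nat \<Rightarrow> ('a \<times> 'a \<Rightarrow>\<^sub>0 'k) set \<Rightarrow> 'k" where
  "coef i r s = tfun (\<lambda>v w. \<eta> i r v * \<eta> i s w)"

lemma bil_\<eta>: "r \<le> count T i \<Longrightarrow> s \<le> count T i \<Longrightarrow> bilinear_form A A (\<lambda>v w. \<eta> i r v * \<eta> i s w)"
  by (intro bilinear_form_prod \<eta>_dual)

lemma flift_free_tensor_mult:
  assumes p: "Poly_Mapping.keys p \<subseteq> carrier A \<times> carrier A"
    and p': "Poly_Mapping.keys p' \<subseteq> carrier A \<times> carrier A"
    and r: "r \<le> count T i" and s: "s \<le> count T i"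
  shows "flift (\<lambda>v w. \<eta> i r v * \<eta> i s w) (free_tensor_mult A A p p')
    = (\<Sum>r'\<le>r. \<Sum>s'\<le>s. flift (\<lambda>v w. \<eta> i r' v * \<eta> i s' w) p
        * flift (\<lambda>v w. \<eta> i (r - r') v * \<eta> i (s - s') w) p')"
proof -
  let ?l = "Poly_Mapping.lookup p" and ?l' = "Poly_Mapping.lookup p'"
  let ?K = "Poly_Mapping.keys p" and ?K' = "Poly_Mapping.keys p'"
  have "flift (\<lambda>v w. \<eta> i r v * \<eta> i s w) (free_tensor_mult A A p p')
      = (\<Sum>x\<in>?K. \<Sum>y\<in>?K'. ?l x * ?l' y *
          (\<eta> i r (fst x \<otimes>\<^bsub>A\<^esub> fst y) * \<eta> i s (snd x \<otimes>\<^bsub>A\<^esub> snd y)))"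
    by (simp add: free_tensor_mult_def plift_sum case_prod_unfold)
  also have "\<dots> = (\<Sum>x\<in>?K. \<Sum>y\<in>?K'. \<Sum>r'\<le>r. \<Sum>s'\<le>s.
      (?l x * (\<eta> i r' (fst x) * \<eta> i s' (snd x))) *
      (?l' y * (\<eta> i (r - r') (fst y) * \<eta> i (s - s') (snd y))))"
  proof (intro sum.cong refl)
    fix x y assume "x \<in> ?K" "y \<in> ?K'"
    then have xy: "fst x \<in> carrier A" "snd x \<in> carrier A" "fst y \<in> carrier A" "snd y \<in> carrier A"
      using p p' by auto
    show "?l x * ?l' y * (\<eta> i r (fst x \<otimes>\<^bsub>A\<^esub> fst y) * \<eta> i s (snd x \<otimes>\<^bsub>A\<^esub> snd y))
      = (\<Sum>r'\<le>r. \<Sum>s'\<le>s. (?l x * (\<eta> i r' (fst x) * \<eta> i s' (snd x))) *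
          (?l' y * (\<eta> i (r - r') (fst y) * \<eta> i (s - s') (snd y))))"
      unfolding \<eta>_mult[OF xy(1,3) r] \<eta>_mult[OF xy(2,4) s] sum_product
      unfolding sum_distrib_left by (simp add: mult_ac)
  qed
  also have "\<dots> = (\<Sum>r'\<le>r. \<Sum>s'\<le>s. \<Sum>x\<in>?K. \<Sum>y\<in>?K'.
      (?l x * (\<eta> i r' (fst x) * \<eta> i s' (snd x))) *
      (?l' y * (\<eta> i (r - r') (fst y) * \<eta> i (s - s') (snd y))))"
    by (rule sum_swap_pairs)
  finally show ?thesis
    unfolding plift_def sum_product .
qed

text \<open>The product of two cosets is a union over representatives. Its membership in the carrier
  makes it a single coset, which must then be the class of the product of two particular
  representatives.\<close>

lemma coef_mult:
  assumes X: "X \<in> carrier (tensor_prod A A)" and Y: "Y \<in> carrier (tensor_prod A A)"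
    and XY: "X \<otimes>\<^bsub>tensor_prod A A\<^esub> Y \<in> carrier (tensor_prod A A)"
    and r: "r \<le> count T i" and s: "s \<le> count T i"
  shows "coef i r s (X \<otimes>\<^bsub>tensor_prod A A\<^esub> Y)
    = (\<Sum>r'\<le>r. \<Sum>s'\<le>s. coef i r' s' X * coef i (r - r') (s - s') Y)"
proof -
  from XY obtain z where z: "X \<otimes>\<^bsub>tensor_prod A A\<^esub> Y = tensor_class A A z"
    by (rule tensor_prod_cases)
  then have "z \<in> X \<otimes>\<^bsub>tensor_prod A A\<^esub> Y" by (simp add: mem_tensor_class)
  then obtain p p' where pp: "p \<in> X" "p' \<in> Y" and zp: "z \<in> tensor_class A A (free_tensor_mult A A p p')"
    by (auto simp: tensor_prod_def)
  have Xp: "X = tensor_class A A p" "Poly_Mapping.keys p \<subseteq> carrier A \<times> carrier A"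
    using X pp(1) keys_tensor_class[OF vs vs] tensor_class_memD by (metis tensor_prod_cases)+
  have Yp: "Y = tensor_class A A p'" "Poly_Mapping.keys p' \<subseteq> carrier A \<times> carrier A"
    using Y pp(2) keys_tensor_class[OF vs vs] tensor_class_memD by (metis tensor_prod_cases)+
  have "X \<otimes>\<^bsub>tensor_prod A A\<^esub> Y = tensor_class A A (free_tensor_mult A A p p')"
    using z tensor_class_memD[OF zp] by simp
  then have "coef i r s (X \<otimes>\<^bsub>tensor_prod A A\<^esub> Y)
      = flift (\<lambda>v w. \<eta> i r v * \<eta> i s w) (free_tensor_mult A A p p')"
    by (simp add: coef_def tfun_class[OF bil_\<eta>[OF r s]])
  also have "\<dots> = (\<Sum>r'\<le>r. \<Sum>s'\<le>s. coef i r' s' X * coef i (r - r') (s - s') Y)"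
    unfolding flift_free_tensor_mult[OF Xp(2) Yp(2) r s] coef_def
    unfolding Xp(1) Yp(1) using r s by (intro sum.cong refl) (simp add: tfun_class[OF bil_\<eta>])
  finally show ?thesis .
qed

text \<open>
  Modulo the other generators, \<open>\<Delta> x\<^sub>i = u + v + \<dots>\<close> with commuting \<open>u = x\<^sub>i \<otimes> 1\<close>, \<open>v = 1 \<otimes> x\<^sub>i\<close> and
  terms divisible by \<open>u v\<close>; so \<open>x\<^sub>i ^ a = 0\<close> kills the degree \<open>a\<close> part of \<open>(u + v) ^ a\<close>.
\<close>

lemma bialgebra_choose_eq_0:
  assumes bi: "bialgebra A \<Delta> \<epsilon>" and i: "i \<in># T" and r: "0 < r" "r < Suc (count T i)"
  shows "of_nat (Suc (count T i) choose r) = (0 :: 'k)"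
proof -
  let ?AA = "tensor_prod A A"
  define N where "N = count T i"
  define y where "y m = e (replicate_mset m i)" for m
  have N: "1 \<le> N" using i by (simp add: N_def)
  have sub: "replicate_mset m i \<subseteq># T \<longleftrightarrow> m \<le> N" for m
    by (simp add: N_def count_le_replicate_mset_subset_eq)
  have y_cl: "y m \<in> carrier A" if "m \<le> N" for m
    using that by (simp add: y_def e_cl sub)
  from bi have lin: "\<Delta> \<in> linear_maps A ?AA" and hom: "\<Delta> \<in> ring_hom A ?AA"
    and \<epsilon>: "\<epsilon> \<in> algebra_hom A base_field" and coalg: "coalgebra A \<Delta> \<epsilon>"
    by (auto simp: bialgebra_def algebra_hom_def)
  have \<Delta>_cl: "\<Delta> a \<in> carrier ?AA" if "a \<in> carrier A" for a
    using linear_mapsD(1)[OF lin that] .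
  have \<epsilon>_eq: "\<epsilon> a = \<eta> i 0 a" if "a \<in> carrier A" for a
    using augmentation_unique[OF \<epsilon> that] by (simp add: \<eta>_def)
  \<comment> \<open>The counit is the constant coordinate, so the counit law determines the
    coordinates of \<open>\<Delta> a\<close> on both axes; nothing is known about the mixed
    ones.\<close>
  have coef_left: "coef i s 0 (\<Delta> a) = \<eta> i s a" if a: "a \<in> carrier A" and s: "s \<le> N" for a s
  proof -
    have d: "\<eta> i s \<in> dual_space A" using s by (simp add: \<eta>_dual N_def)
    have "\<eta> i s a = \<eta> i s (tensor_lift A (\<lambda>a1 a2. \<epsilon> a2 \<odot>\<^bsub>A\<^esub> a1) (\<Delta> a))"
      using coalg a by (simp add: coalgebra_def Let_def)
    also have "\<dots> = tfun (\<lambda>v w. \<eta> i s (\<epsilon> w \<odot>\<^bsub>A\<^esub> v)) (\<Delta> a)"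
      by (intro dual_tensor_lift[OF vs vs vs] \<Delta>_cl a vs_smult_closed[OF vs] d)
    also have "\<dots> = coef i s 0 (\<Delta> a)"
      unfolding coef_def
      by (rule tfun_cong[OF vs vs \<Delta>_cl[OF a]]) (simp add: dual_smult[OF d] \<epsilon>_eq)
    finally show ?thesis by simp
  qed
  have coef_right: "coef i 0 s (\<Delta> a) = \<eta> i s a" if a: "a \<in> carrier A" and s: "s \<le> N" for a s
  proof -
    have d: "\<eta> i s \<in> dual_space A" using s by (simp add: \<eta>_dual N_def)
    have "\<eta> i s a = \<eta> i s (tensor_lift A (\<lambda>a1 a2. \<epsilon> a1 \<odot>\<^bsub>A\<^esub> a2) (\<Delta> a))"
      using coalg a by (simp add: coalgebra_def Let_def)
    also have "\<dots> = tfun (\<lambda>v w. \<eta> i s (\<epsilon> v \<odot>\<^bsub>A\<^esub> w)) (\<Delta> a)"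
      by (intro dual_tensor_lift[OF vs vs vs] \<Delta>_cl a vs_smult_closed[OF vs] d)
    also have "\<dots> = coef i 0 s (\<Delta> a)"
      unfolding coef_def
      by (rule tfun_cong[OF vs vs \<Delta>_cl[OF a]]) (simp add: dual_smult[OF d] \<epsilon>_eq)
    finally show ?thesis by simp
  qed
  have \<eta>_y: "\<eta> i s (y m) = (if s = m then 1 else 0)" if "s \<le> N" "m \<le> N" for s m
    using that by (simp add: \<eta>_def y_def \<xi>_eq sub replicate_mset_eq_iff)
  have c: "coef i 0 0 (\<Delta> (y 1)) = 0" "coef i 1 0 (\<Delta> (y 1)) = 1" "coef i 0 1 (\<Delta> (y 1)) = 1"
    using N by (auto simp: coef_left coef_right y_cl \<eta>_y)
  have step: "coef i s s' (\<Delta> (y 1 \<otimes>\<^bsub>A\<^esub> y m))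
      = (\<Sum>r1\<le>s. \<Sum>r2\<le>s'. coef i r1 r2 (\<Delta> (y 1)) * coef i (s - r1) (s' - r2) (\<Delta> (y m)))"
    if "s \<le> N" "s' \<le> N" "m \<le> N" for s s' m
  proof -
    have eq: "\<Delta> (y 1 \<otimes>\<^bsub>A\<^esub> y m) = \<Delta> (y 1) \<otimes>\<^bsub>?AA\<^esub> \<Delta> (y m)"
      using ring_hom_mult[OF hom] y_cl N that by blast
    \<comment> \<open>Closure of this product comes from the homomorphism: it is the image of an
      element of \<open>A\<close>.\<close>
    have cl: "\<Delta> (y 1) \<otimes>\<^bsub>?AA\<^esub> \<Delta> (y m) \<in> carrier ?AA"
      unfolding eq[symmetric] using that N by (intro \<Delta>_cl mult_closed y_cl)
    show ?thesis
      unfolding eq using that N by (intro coef_mult \<Delta>_cl y_cl cl) (auto simp: N_def)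
  qed
  have main: "coef i s s' (\<Delta> (y m)) = (if s + s' < m then 0 else of_nat (m choose s))"
    if "m \<le> N" "s \<le> N" "s' \<le> N" "s + s' \<le> m" for m s s'
    using that
  proof (induction m arbitrary: s s')
    case 0
    then show ?case by (simp add: coef_left y_cl \<eta>_y)
  next
    case (Suc m)
    have "y (Suc m) = y 1 \<otimes>\<^bsub>A\<^esub> y m"
      using Suc.prems N e_mult[of "{#i#}" "replicate_mset m i"] \<kappa>_replicate[of 1 i m]
      by (simp add: y_def sub[of 1, simplified] sub sub[of "Suc m", simplified] vs_smult_one[OF vs] e_cl)
    then have "coef i s s' (\<Delta> (y (Suc m)))
        = (\<Sum>r1\<le>s. \<Sum>r2\<le>s'. coef i r1 r2 (\<Delta> (y 1)) * coef i (s - r1) (s' - r2) (\<Delta> (y m)))"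
      using step[of s s' m] Suc.prems by simp
    also have "\<dots> = (if s + s' < Suc m then 0 else of_nat (Suc m choose s))"
      using Suc by (intro convolution_binomial_step c) auto
    finally show ?case .
  qed
  \<comment> \<open>Since \<open>0 < r < Suc N\<close>, both exponents stay at most
    \<open>N\<close>, so the coordinate exists in the basis although the total degree
    \<open>Suc N\<close> is that of the vanishing power.\<close>
  let ?s = "Suc N - r"
  have rs: "r \<le> N" "?s \<le> N" "r + ?s = Suc N" using r by (auto simp: N_def)
  have "y 1 \<otimes>\<^bsub>A\<^esub> y N = \<zero>\<^bsub>A\<^esub>"
    using N e_mult[of "{#i#}" "replicate_mset N i"] sub[of "Suc N"] sub[of 1] sub[of N]
    by (simp add: y_def)
  \<comment> \<open>Zero is written as a multiple by 0, so that linearity in scalars alone gives the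
    value 0.\<close>
  then have "coef i r ?s (\<Delta> (y 1 \<otimes>\<^bsub>A\<^esub> y N)) = coef i r ?s (0 \<odot>\<^bsub>?AA\<^esub> \<Delta> \<zero>\<^bsub>A\<^esub>)"
    using linear_mapsD(3)[OF lin vs_zero_closed[OF vs], of 0]
    by (simp add: vs_zero_smult[OF vs] vs_zero_closed[OF vs])
  also have "\<dots> = 0"
    unfolding coef_def using rs
    by (subst dual_smult[OF tfun_dual[OF bil_\<eta>]])
      (auto simp: N_def intro: \<Delta>_cl vs_zero_closed[OF vs])
  finally have "0 = (\<Sum>r1\<le>r. \<Sum>r2\<le>?s. coef i r1 r2 (\<Delta> (y 1)) * coef i (r - r1) (?s - r2) (\<Delta> (y N)))"
    using step[of r ?s N] rs by simp
  also have "\<dots> = (if r + ?s < Suc N then 0 else of_nat (Suc N choose r))"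
    using rs by (intro convolution_binomial_step c main) auto
  finally show ?thesis using rs by (simp add: N_def)
qed

lemma no_bialgebra:
  assumes "i \<in># T" "\<nexists>m. Suc (count T i) = CHAR('k) ^ m"
  shows "\<not> admits_bialgebra A"
proof
  assume "admits_bialgebra A"
  then obtain \<Delta> \<epsilon> where bi: "bialgebra A \<Delta> \<epsilon>" by (auto simp: admits_bialgebra_def)
  have "count T i > 0" using assms(1) by simp
  then have "\<exists>m. Suc (count T i) = CHAR('k) ^ m"
    by (intro eq_CHAR_power_if_choose_eq_0 bialgebra_choose_eq_0[OF bi assms(1)]) auto
  with assms(2) show False by blast
qed

end

section \<open>The monomial basis of a quantum complete intersection\<close>

text \<open>Scalars act as multiples of the empty word; hence ring ideals of the free algebra are
  closed under scaling.\<close>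

lemma scale_eq_mult: "scale c p = Poly_Mapping.single [] c * (p :: 'x list \<Rightarrow>\<^sub>0 'k::field)"
proof -
  have "Poly_Mapping.single [] c * p = (\<Sum>w\<in>Poly_Mapping.keys p.
      Poly_Mapping.single [] c * Poly_Mapping.single w (Poly_Mapping.lookup p w))"
    by (subst poly_mapping_eq_sum_single[of p]) (simp add: sum_distrib_left)
  also have "\<dots> = (\<Sum>w\<in>Poly_Mapping.keys p. scale c (Poly_Mapping.single w (Poly_Mapping.lookup p w)))"
    by (simp add: mult_single scale_single plus_list_def)
  also have "\<dots> = scale c p"
    unfolding scale_sum[symmetric] poly_mapping_eq_sum_single[symmetric] ..
  finally show ?thesis by simp
qed

lemma scale_mult_left: "scale c p * p' = scale c (p * (p' :: 'x list \<Rightarrow>\<^sub>0 'k::field))"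
  unfolding scale_eq_mult by (rule mult.assoc)

lemma scale_mult_right: "p * scale c p' = scale c (p * (p' :: 'x list \<Rightarrow>\<^sub>0 'k::field))"
proof -
  have "p * Poly_Mapping.single [] c = (\<Sum>w\<in>Poly_Mapping.keys p.
      Poly_Mapping.single w (Poly_Mapping.lookup p w) * Poly_Mapping.single [] c)"
    by (subst poly_mapping_eq_sum_single[of p]) (simp add: sum_distrib_right)
  also have "\<dots> = (\<Sum>w\<in>Poly_Mapping.keys p. scale c (Poly_Mapping.single w (Poly_Mapping.lookup p w)))"
    by (simp add: mult_single scale_single plus_list_def mult.commute)
  also have "\<dots> = scale c p"
    unfolding scale_sum[symmetric] poly_mapping_eq_sum_single[symmetric] ..
  finally have "p * Poly_Mapping.single [] c = scale c p" .
  then show ?thesis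
    by (metis mult.assoc scale_eq_mult)
qed

lemma plift_mult:
  fixes p p' :: "'x list \<Rightarrow>\<^sub>0 'k::field"
  shows "plift h (p * p') = (\<Sum>u\<in>Poly_Mapping.keys p. \<Sum>v\<in>Poly_Mapping.keys p'.
    Poly_Mapping.lookup p u * Poly_Mapping.lookup p' v * h (u @ v))"
proof -
  have "p * p' = (\<Sum>u\<in>Poly_Mapping.keys p. Poly_Mapping.single u (Poly_Mapping.lookup p u))
      * (\<Sum>v\<in>Poly_Mapping.keys p'. Poly_Mapping.single v (Poly_Mapping.lookup p' v))"
    by (simp flip: poly_mapping_eq_sum_single)
  also have "\<dots> = (\<Sum>u\<in>Poly_Mapping.keys p. \<Sum>v\<in>Poly_Mapping.keys p'.
      Poly_Mapping.single (u @ v) (Poly_Mapping.lookup p u * Poly_Mapping.lookup p' v))"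
    by (simp add: sum_product mult_single plus_list_def)
  finally show ?thesis by (simp add: plift_sum)
qed

section \<open>The free algebra as a ring\<close>

lemma free_algebra_simps [simp]:
  "monoid.mult (free_algebra n) = (*)" "one (free_algebra n) = 1" "zero (free_algebra n) = 0"
  "add (free_algebra n) = (+)" "smult (free_algebra n) = scale"
  by (simp_all add: free_algebra_def)

lemma carrier_free_algebra:
  "p \<in> carrier (free_algebra n) \<longleftrightarrow> (\<forall>w\<in>Poly_Mapping.keys p. set w \<subseteq> {1..n})"
  by (simp add: free_algebra_def)

lemma single_in_free_algebra:
  "set w \<subseteq> {1..n} \<Longrightarrow> Poly_Mapping.single w c \<in> carrier (free_algebra n)"
  by (simp add: carrier_free_algebra)

lemma free_algebra_closed:
  fixes p p' :: "nat list \<Rightarrow>\<^sub>0 'k::field"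
  assumes "p \<in> carrier (free_algebra n)" "p' \<in> carrier (free_algebra n)"
  shows "p + p' \<in> carrier (free_algebra n)" "p * p' \<in> carrier (free_algebra n)"
  using assms keys_add[of p p'] keys_mult[of p p']
  unfolding carrier_free_algebra by (fastforce simp: plus_list_def)+

lemma scale_in_free_algebra:
  fixes p :: "nat list \<Rightarrow>\<^sub>0 'k::field"
  shows "p \<in> carrier (free_algebra n) \<Longrightarrow> scale c p \<in> carrier (free_algebra n)"
  unfolding scale_eq_mult by (intro free_algebra_closed single_in_free_algebra) auto

lemma ring_free_algebra: "ring (free_algebra n :: ('k::field, nat list \<Rightarrow>\<^sub>0 'k) module)"
proof (rule ringI)
  let ?F = "free_algebra n :: ('k, nat list \<Rightarrow>\<^sub>0 'k) module"
  show "abelian_group ?F"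
  proof (rule abelian_groupI)
    fix p assume "p \<in> carrier ?F"
    then show "\<exists>y\<in>carrier ?F. y \<oplus>\<^bsub>?F\<^esub> p = \<zero>\<^bsub>?F\<^esub>"
      by (intro bexI[of _ "- p"]) (simp_all add: carrier_free_algebra in_keys_iff)
  qed (simp_all add: free_algebra_closed add_ac, simp add: carrier_free_algebra)
  show "monoid ?F"
    by (rule monoidI)
      (simp_all add: free_algebra_closed mult.assoc, simp add: carrier_free_algebra zero_list_def)
qed (simp_all add: algebra_simps)

text \<open>Sorting makes equal letters adjacent, so a power of a generator becomes a contiguous
  factor to which a relation applies.\<close>

lemma sort_split_replicate:
  fixes w :: "'x::linorder list"
  assumes "k \<le> count (mset w) i"
  obtains u v where "sort w = u @ replicate k i @ v" "set u \<subseteq> set w" "set v \<subseteq> set w"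
proof (cases "k = 0")
  case True
  then show ?thesis using that[of "[]" "sort w"] by auto
next
  case False
  let ?c = "count (mset w) i"
  let ?u = "sort (filter (\<lambda>x. x < i) w)" and ?v = "sort (filter (\<lambda>x. x > i) w)"
  have "i \<in> set w" using False assms by (metis count_eq_zero_iff le_zero_eq set_mset_mset)
  have "mset (?u @ replicate ?c i @ ?v) = mset w"
    by (rule multiset_eqI) (auto simp: not_less_iff_gr_or_eq count_eq_zero_iff)
  then have "sort w = ?u @ replicate ?c i @ ?v"
    by (rule properties_for_sort) (auto simp: sorted_append)
  also have "replicate ?c i = replicate k i @ replicate (?c - k) i"
    using assms by (simp flip: replicate_add)
  finally show ?thesis
    using \<open>i \<in> set w\<close> by (intro that[of ?u "replicate (?c - k) i @ ?v"]) auto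
qed

lemma ring_quotient_algebra:
  assumes "ideal I R"
  shows "ring (quotient_algebra R I)"
proof -
  interpret Q: ring "R Quot I" by (rule ideal.quotient_is_ring[OF assms])
  have sel: "carrier (quotient_algebra R I) = carrier (R Quot I)"
    "monoid.mult (quotient_algebra R I) = monoid.mult (R Quot I)"
    "one (quotient_algebra R I) = one (R Quot I)"
    "zero (quotient_algebra R I) = zero (R Quot I)"
    "add (quotient_algebra R I) = add (R Quot I)"
    by (simp_all add: quotient_algebra_def)
  show ?thesis
  proof (rule ringI)
    show "abelian_group (quotient_algebra R I)"
    proof (rule abelian_groupI, unfold sel)
      fix x assume "x \<in> carrier (R Quot I)"
      then show "\<exists>y\<in>carrier (R Quot I). y \<oplus>\<^bsub>R Quot I\<^esub> x = \<zero>\<^bsub>R Quot I\<^esub>"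
        using Q.l_neg Q.a_inv_closed by blast
    qed (simp_all add: Q.a_ac)
    show "monoid (quotient_algebra R I)"
      by (rule monoidI, unfold sel) (simp_all add: Q.m_assoc)
  qed (unfold sel, simp_all add: Q.l_distr Q.r_distr)
qed

locale qci =
  fixes n :: nat and q :: "nat \<Rightarrow> nat \<Rightarrow> 'k::field" and a :: "nat \<Rightarrow> nat"
  assumes n: "n \<ge> 1"
    and a: "i \<in> {1..n} \<Longrightarrow> a i \<ge> 2"
    and q_diag: "i \<in> {1..n} \<Longrightarrow> q i i = - 1"
    and q_sym: "i \<in> {1..n} \<Longrightarrow> j \<in> {1..n} \<Longrightarrow> q i j * q j i = 1"
    and q_square: "i \<in> {1..n} \<Longrightarrow> j \<in> {1..n} \<Longrightarrow> q i j ^ 2 = 1"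
begin

abbreviation F :: "('k, nat list \<Rightarrow>\<^sub>0 'k) module" where "F \<equiv> free_algebra n"

abbreviation J :: "(nat list \<Rightarrow>\<^sub>0 'k) set" where "J \<equiv> Idl\<^bsub>F\<^esub> (qci_relations n q a)"

abbreviation A :: "('k, (nat list \<Rightarrow>\<^sub>0 'k) set) module" where
  "A \<equiv> quantum_complete_intersection n q a"

definition T :: "nat multiset" where
  "T = (\<Sum>i\<in>{1..n}. replicate_mset (a i - 1) i)"

text \<open>The factor for turning an inversion \<open>i j\<close> into \<open>j i\<close>. Its
  value 1 elsewhere, including out of range, lets the sign identities hold for arbitrary
  multisets.\<close>

definition sg :: "nat \<Rightarrow> nat \<Rightarrow> 'k" where
  "sg i j = (if j < i \<and> i \<in> {1..n} \<and> j \<in> {1..n} then - q i j else 1)"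

definition \<kappa> :: "nat multiset \<Rightarrow> nat multiset \<Rightarrow> 'k" where
  "\<kappa> M N = (\<Prod>i\<in>#M. \<Prod>j\<in>#N. sg i j)"

text \<open>
  \<open>sgw w\<close> is the sign with which the relations sort the word \<open>w\<close>; accordingly \<open>cf M p\<close> is the
  coefficient of the ordered monomial \<open>M\<close> in the class of \<open>p\<close>.
\<close>

fun sgw :: "nat list \<Rightarrow> 'k" where
  "sgw [] = 1"
| "sgw (i # w) = \<kappa> {#i#} (mset w) * sgw w"

definition cf :: "nat multiset \<Rightarrow> (nat list \<Rightarrow>\<^sub>0 'k) \<Rightarrow> 'k" where
  "cf M = plift (\<lambda>w. if mset w = M then sgw w else 0)"

definition nf :: "nat multiset \<Rightarrow> (nat list \<Rightarrow>\<^sub>0 'k)" where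
  "nf M = Poly_Mapping.single (sorted_list_of_multiset M) 1"

section \<open>Signs and coefficients of words\<close>

lemma count_T: "count T i = (if i \<in> {1..n} then a i - 1 else 0)"
  by (simp add: T_def count_sum if_distrib cong: if_cong)

lemma set_T: "M \<subseteq># T \<Longrightarrow> set_mset M \<subseteq> {1..n}"
  by (metis count_T count_greater_zero_iff mset_subset_eqD less_irrefl subsetI)

lemma \<kappa>_add_left: "\<kappa> (M + M') N = \<kappa> M N * \<kappa> M' N"
  by (simp add: \<kappa>_def)

lemma \<kappa>_add_right: "\<kappa> M (N + N') = \<kappa> M N * \<kappa> M N'"
  by (simp add: \<kappa>_def prod_mset.distrib)

lemma sg_square: "sg i j * sg i j = 1"
  using q_square[of i j] by (auto simp: sg_def power2_eq_square)

lemma \<kappa>_square: "\<kappa> M N * \<kappa> M N = 1"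
  by (simp add: \<kappa>_def sg_square flip: prod_mset.distrib)

lemma \<kappa>_single [simp]: "\<kappa> {#i#} {#j#} = sg i j"
  by (simp add: \<kappa>_def)

lemma \<kappa>_empty [simp]: "\<kappa> {#} N = 1" "\<kappa> M {#} = 1"
  by (simp_all add: \<kappa>_def)

lemma \<kappa>_min: "(\<And>j. j \<in># N \<Longrightarrow> i \<le> j) \<Longrightarrow> \<kappa> {#i#} N = 1"
proof (induction N)
  case (add j N)
  then have "\<not> j < i" by (simp add: not_less)
  with add show ?case by (simp add: \<kappa>_def sg_def)
qed simp

text \<open>The inversions of \<open>u @ v\<close> lie inside \<open>u\<close>, inside
  \<open>v\<close>, or between them, and the last kind depends only on the two multisets.\<close>

lemma sgw_append: "sgw (u @ v) = \<kappa> (mset u) (mset v) * sgw u * sgw v"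
proof (induction u)
  case (Cons i u)
  then show ?case
    using \<kappa>_add_left[of "{#i#}" "mset u" "mset v"] by (simp add: \<kappa>_add_right mult_ac)
qed simp

lemma sgw_sorted: "sorted w \<Longrightarrow> sgw w = 1"
  by (induction w) (auto intro!: \<kappa>_min)

lemma cf_single: "cf M (Poly_Mapping.single w c) = (if mset w = M then c * sgw w else 0)"
  by (simp add: cf_def)

lemma cf_nf: "cf M (nf N) = (if M = N then 1 else 0)"
  by (simp add: nf_def cf_single sgw_sorted)

text \<open>For a pair of words only the splitting with \<open>M = mset u\<close> contributes, and
  \<open>sgw_append\<close> gives its sign; the rest is bilinear extension.\<close>

lemma cf_mult: "cf R (p * p') = (\<Sum>M | M \<subseteq># R. \<kappa> M (R - M) * cf M p * cf (R - M) p')"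
proof -
  let ?h = "\<lambda>M w. if mset w = M then sgw w else 0"
  let ?K = "Poly_Mapping.keys p" and ?K' = "Poly_Mapping.keys p'"
  let ?l = "Poly_Mapping.lookup p" and ?l' = "Poly_Mapping.lookup p'"
  have h: "?h R (u @ v) = (\<Sum>M | M \<subseteq># R. \<kappa> M (R - M) * ?h M u * ?h (R - M) v)" for u v
  proof -
    have "(\<Sum>M | M \<subseteq># R. \<kappa> M (R - M) * ?h M u * ?h (R - M) v)
        = (\<Sum>M | M \<subseteq># R. if M = mset u then \<kappa> M (R - M) * sgw u * ?h (R - M) v else 0)"
      by (intro sum.cong) auto
    also have "\<dots> = (if mset u \<subseteq># R then \<kappa> (mset u) (R - mset u) * sgw u * ?h (R - mset u) v else 0)"
      by (simp add: finite_submultisets)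
    also have "\<dots> = ?h R (u @ v)"
    proof (cases "mset u \<subseteq># R")
      case True
      then have "mset v = R - mset u \<longleftrightarrow> mset (u @ v) = R"
        by (auto dest: subset_mset.add_diff_inverse)
      then show ?thesis using True by (auto simp: sgw_append)
    qed auto
    finally show ?thesis by (rule sym)
  qed
  have "cf R (p * p') = (\<Sum>u\<in>?K. \<Sum>v\<in>?K'. \<Sum>M | M \<subseteq># R.
      \<kappa> M (R - M) * ((?l u * ?h M u) * (?l' v * ?h (R - M) v)))"
    unfolding cf_def plift_mult h sum_distrib_left by (simp only: mult_ac)
  also have "\<dots> = (\<Sum>u\<in>?K. \<Sum>M | M \<subseteq># R. \<Sum>v\<in>?K'.
      \<kappa> M (R - M) * ((?l u * ?h M u) * (?l' v * ?h (R - M) v)))"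
    by (rule sum.cong[OF refl], rule sum.swap)
  also have "\<dots> = (\<Sum>M | M \<subseteq># R. \<Sum>u\<in>?K. \<Sum>v\<in>?K'.
      \<kappa> M (R - M) * ((?l u * ?h M u) * (?l' v * ?h (R - M) v)))"
    by (rule sum.swap)
  also have "\<dots> = (\<Sum>M | M \<subseteq># R. \<kappa> M (R - M) * cf M p * cf (R - M) p')"
    unfolding cf_def plift_def mult.assoc sum_product unfolding sum_distrib_left ..
  finally show ?thesis .
qed

section \<open>The ideal of relations and normal forms\<close>

lemma relations_closed: "qci_relations n q a \<subseteq> carrier F"
proof -
  have gen: "gen i \<in> carrier F" if "i \<in> {1..n}" for i
    using that by (intro single_in_free_algebra) simp
  have pow: "gen i ^ m \<in> carrier F" if "i \<in> {1..n}" for i m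
  proof (induction m)
    case 0
    then show ?case by (simp add: carrier_free_algebra zero_list_def)
  qed (auto intro!: free_algebra_closed gen simp: that[simplified])
  show ?thesis
    by (auto simp: qci_relations_def intro!: pow free_algebra_closed scale_in_free_algebra gen)
qed

lemma gen_power: "(gen i :: nat list \<Rightarrow>\<^sub>0 'k) ^ m = Poly_Mapping.single (replicate m i) 1"
proof (induction m)
  case 0
  show ?case by (simp add: zero_list_def flip: single_one)
qed (simp add: mult_single plus_list_def)

lemma ideal_J: "ideal J F"
  by (intro ring.genideal_ideal ring_free_algebra relations_closed)

lemma J_add: "x \<in> J \<Longrightarrow> y \<in> J \<Longrightarrow> x + y \<in> J"
  using additive_subgroup.a_closed[OF ideal.axioms(1)[OF ideal_J]] by simp

lemma J_zero: "0 \<in> J"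
  using additive_subgroup.zero_closed[OF ideal.axioms(1)[OF ideal_J]] by simp

lemma J_mult_left: "x \<in> J \<Longrightarrow> p \<in> carrier F \<Longrightarrow> p * x \<in> J"
  using ideal.I_l_closed[OF ideal_J] by simp

lemma J_mult_right: "x \<in> J \<Longrightarrow> p \<in> carrier F \<Longrightarrow> x * p \<in> J"
  using ideal.I_r_closed[OF ideal_J] by simp

lemma J_scale: "x \<in> J \<Longrightarrow> scale c x \<in> J"
  unfolding scale_eq_mult by (intro J_mult_left single_in_free_algebra) auto

lemma J_diff: "x \<in> J \<Longrightarrow> y \<in> J \<Longrightarrow> x - y \<in> J"
  using J_add[of x "- y"] J_scale[of y "-1"] by (simp add: scale_minus_one)

lemma J_sum: "(\<And>x. x \<in> K \<Longrightarrow> g x \<in> J) \<Longrightarrow> sum g K \<in> J"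
  by (induction K rule: infinite_finite_induct) (auto intro: J_zero J_add)

text \<open>Linear independence of the monomials: the common kernel of the coordinates below
  \<open>T\<close> is an ideal containing the relations, so it contains \<open>J\<close>.\<close>

lemma cf_J:
  assumes "x \<in> J" "R \<subseteq># T"
  shows "cf R x = 0"
proof -
  define K where "K = {p \<in> carrier F. \<forall>R. R \<subseteq># T \<longrightarrow> cf R p = 0}"
  interpret F: ring F by (rule ring_free_algebra)
  \<comment> \<open>A product coordinate at \<open>R\<close> involves only submultisets of
    \<open>R\<close>, which are again below \<open>T\<close>; so one factor in \<open>K\<close>
    suffices.\<close>
  have K_mult: "p * p' \<in> K" if "p \<in> K \<or> p' \<in> K" "p \<in> carrier F" "p' \<in> carrier F" for p p'
  proof -
    have "cf R (p * p') = 0" if "R \<subseteq># T" for R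
      unfolding cf_mult
    proof (rule sum.neutral, rule ballI)
      fix M assume "M \<in> {M. M \<subseteq># R}"
      then have "M \<subseteq># T" "R - M \<subseteq># T"
        using that by (auto intro: subset_mset.order_trans[OF diff_subset_eq_self])
      then show "\<kappa> M (R - M) * cf M p * cf (R - M) p' = 0"
        using \<open>p \<in> K \<or> p' \<in> K\<close> by (auto simp: K_def)
    qed
    then show ?thesis using that by (simp add: K_def free_algebra_closed)
  qed
  have "ideal K F"
  proof (rule idealI)
    show "subgroup K (add_monoid F)"
    proof (rule F.add.subgroupI)
      show "K \<subseteq> carrier F" by (auto simp: K_def)
      show "K \<noteq> {}" by (auto simp: K_def cf_def carrier_free_algebra intro!: exI[of _ 0])
      fix p assume p: "p \<in> K"
      then have "- p \<in> K"
        using K_mult[of "Poly_Mapping.single [] (- 1)" p]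
        by (simp add: single_in_free_algebra K_def scale_minus_one flip: scale_eq_mult)
      moreover have "\<ominus>\<^bsub>F\<^esub> p = - p"
        using p calculation by (intro F.minus_equality) (auto simp: K_def)
      ultimately show "\<ominus>\<^bsub>F\<^esub> p \<in> K" by simp
      fix p' assume "p' \<in> K"
      with p show "p \<oplus>\<^bsub>F\<^esub> p' \<in> K"
        by (simp add: K_def free_algebra_closed cf_def plift_add)
    qed
  qed (auto simp: ring_free_algebra intro!: K_mult, auto simp: K_def)
  moreover have "qci_relations n q a \<subseteq> K"
  proof
    fix p assume p: "p \<in> qci_relations n q a"
    have "cf R p = 0" if R: "R \<subseteq># T" for R
      using p unfolding qci_relations_def
    proof (elim UnE CollectE exE conjE)
      fix i assume i: "p = gen i ^ a i" "i \<in> {1..n}"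
      have "count R i < a i"
        using mset_subset_eq_count[OF R, of i] i(2) a[of i] by (simp add: count_T)
      then have "replicate_mset (a i) i \<noteq> R" by auto
      then show "cf R p = 0" by (simp add: i(1) gen_power cf_single)
    next
      fix i j assume p: "p = gen i * gen j + scale (q i j) (gen j * gen i)"
        and ij: "i \<in> {1..n}" "j \<in> {1..n}"
      have "cf R p = (if {#i, j#} = R then sg i j + q i j * sg j i else 0)"
        by (simp add: p cf_def plift_add plift_scale mult_single plus_list_def add_mset_commute)
      \<comment> \<open>For \<open>i = j\<close> this is \<open>q i i = -1\<close>. For
        \<open>i > j\<close> the two terms cancel directly, and for \<open>i < j\<close> they cancel
        because \<open>q i j * q j i = 1\<close>.\<close>
      also have "sg i j + q i j * sg j i = 0"
        using ij q_sym[OF ij] q_diag[of i] by (cases i j rule: linorder_cases) (auto simp: sg_def)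
      finally show "cf R p = 0" by simp
    qed
    then show "p \<in> K" using p relations_closed by (auto simp: K_def)
  qed
  ultimately have "J \<subseteq> K" by (rule F.genideal_minimal)
  then show ?thesis using assms by (auto simp: K_def)
qed

text \<open>One pass of insertion sort: moving \<open>i\<close> past a smaller letter
  \<open>j\<close> costs \<open>- q i j\<close>. Once \<open>i\<close> meets a letter at least as
  large, sortedness of the rest makes the remaining sign 1.\<close>

lemma insort_mod_J:
  assumes "sorted v" "set v \<subseteq> {1..n}" "i \<in> {1..n}"
  shows "Poly_Mapping.single (i # v) 1 - Poly_Mapping.single (insort i v) (\<kappa> {#i#} (mset v)) \<in> J"
  using assms(1,2)
proof (induction v)
  case Nil
  then show ?case by (simp add: J_zero)
next
  case (Cons j v)
  show ?case
  proof (cases "i \<le> j")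
    case True
    then have "\<kappa> {#i#} (mset (j # v)) = 1" using Cons.prems by (intro \<kappa>_min) auto
    then show ?thesis using True by (simp add: J_zero)
  next
    case False
    let ?s = "\<lambda>w. Poly_Mapping.single w :: 'k \<Rightarrow> _"
    have j: "j \<in> {1..n}" using Cons.prems by simp
    have "gen i * gen j + scale (q i j) (gen j * gen i) \<in> J"
      using assms(3) j ring.genideal_self[OF ring_free_algebra relations_closed]
      by (auto simp: qci_relations_def)
    then have "(gen i * gen j + scale (q i j) (gen j * gen i)) * ?s v 1 \<in> J"
      using Cons.prems by (intro J_mult_right single_in_free_algebra) auto
    then have 1: "?s (i # j # v) 1 + ?s (j # i # v) (q i j) \<in> J"
      by (simp add: mult_single plus_list_def scale_single distrib_right)
    \<comment> \<open>The induction hypothesis is multiplied on the left by \<open>x_j\<close> and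
      weighted by \<open>q i j\<close>, to match the swapped term of the relation.\<close>
    have "?s [j] (q i j) * (?s (i # v) 1 - ?s (insort i v) (\<kappa> {#i#} (mset v))) \<in> J"
      using Cons j by (intro J_mult_left single_in_free_algebra) auto
    then have 2: "?s (j # i # v) (q i j) - ?s (j # insort i v) (q i j * \<kappa> {#i#} (mset v)) \<in> J"
      by (simp add: mult_single plus_list_def right_diff_distrib)
    have "\<kappa> {#i#} (mset (j # v)) = - (q i j * \<kappa> {#i#} (mset v))"
      using \<kappa>_add_right[of "{#i#}" "{#j#}" "mset v"] False assms(3) j by (simp add: sg_def)
    then show ?thesis
      using J_diff[OF 1 2] False by (simp add: single_uminus)
  qed
qed

lemma sort_mod_J:
  "set w \<subseteq> {1..n} \<Longrightarrow> Poly_Mapping.single w 1 - Poly_Mapping.single (sort w) (sgw w) \<in> J"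
proof (induction w)
  case Nil
  then show ?case by (simp add: J_zero)
next
  case (Cons i w)
  let ?s = "\<lambda>w. Poly_Mapping.single w :: 'k \<Rightarrow> _"
  have "?s [i] 1 * (?s w 1 - ?s (sort w) (sgw w)) \<in> J"
    using Cons by (intro J_mult_left single_in_free_algebra) auto
  then have 1: "?s (i # w) 1 - ?s (i # sort w) (sgw w) \<in> J"
    by (simp add: mult_single plus_list_def right_diff_distrib)
  have "scale (sgw w) (?s (i # sort w) 1 - ?s (insort i (sort w)) (\<kappa> {#i#} (mset (sort w)))) \<in> J"
    using Cons.prems by (intro J_scale insort_mod_J) auto
  then have 2: "?s (i # sort w) (sgw w) - ?s (insort i (sort w)) (sgw (i # w)) \<in> J"
    by (simp add: scale_diff scale_single mult.commute)
  show ?case using J_add[OF 1 2] by simp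
qed

text \<open>Exceeding \<open>T\<close> at a letter \<open>i\<close> means at least
  \<open>a i\<close> copies of it, and sorting collects them into a vanishing power.\<close>

lemma word_in_J:
  assumes "set w \<subseteq> {1..n}" "\<not> mset w \<subseteq># T"
  shows "Poly_Mapping.single (sort w) c \<in> J"
proof -
  obtain i where i: "count T i < count (mset w) i"
    using assms(2) by (auto simp: subseteq_mset_def not_le)
  then have "i \<in> set w" by (metis count_eq_zero_iff not_less_zero set_mset_mset)
  then have i1: "i \<in> {1..n}" using assms(1) by auto
  then have "a i \<le> count (mset w) i" using i a[of i] by (simp add: count_T)
  then obtain u v where uv: "sort w = u @ replicate (a i) i @ v" "set u \<subseteq> set w" "set v \<subseteq> set w"
    by (rule sort_split_replicate)
  have "gen i ^ a i \<in> J"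
    using i1 ring.genideal_self[OF ring_free_algebra relations_closed]
    by (auto simp: qci_relations_def)
  then have "Poly_Mapping.single u c * (gen i ^ a i * Poly_Mapping.single v 1) \<in> J"
    using uv assms(1) by (intro J_mult_left J_mult_right single_in_free_algebra) auto
  then show ?thesis by (simp add: gen_power mult_single plus_list_def uv(1))
qed

text \<open>Spanning by the monomials below \<open>T\<close>, with the same coefficients that
  \<open>cf_J\<close> shows to be invariants of the class.\<close>

lemma normal_form_mod_J:
  assumes "p \<in> carrier F"
  shows "p - (\<Sum>M | M \<subseteq># T. scale (cf M p) (nf M)) \<in> J"
proof -
  let ?l = "Poly_Mapping.lookup p" and ?K = "Poly_Mapping.keys p"
  have word: "Poly_Mapping.single w c
      - (\<Sum>M | M \<subseteq># T. scale (c * (if mset w = M then sgw w else 0)) (nf M)) \<in> J"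
    if w: "set w \<subseteq> {1..n}" for w c
  proof -
    have "(\<Sum>M | M \<subseteq># T. scale (c * (if mset w = M then sgw w else 0)) (nf M))
        = (\<Sum>M | M \<subseteq># T. if M = mset w then Poly_Mapping.single (sort w) (c * sgw w) else 0)"
      by (intro sum.cong) (auto simp: nf_def scale_single)
    also have "\<dots> = (if mset w \<subseteq># T then Poly_Mapping.single (sort w) (c * sgw w) else 0)"
      by (simp add: finite_submultisets)
    finally have eq: "(\<Sum>M | M \<subseteq># T. scale (c * (if mset w = M then sgw w else 0)) (nf M))
      = (if mset w \<subseteq># T then Poly_Mapping.single (sort w) (c * sgw w) else 0)" .
    have 1: "Poly_Mapping.single w c - Poly_Mapping.single (sort w) (c * sgw w) \<in> J"
      using J_scale[OF sort_mod_J[OF w], of c] by (simp add: scale_diff scale_single)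
    show ?thesis
      unfolding eq using 1 J_add[OF 1 word_in_J[OF w, of "c * sgw w"]] by simp
  qed
  have "(\<Sum>w\<in>?K. Poly_Mapping.single w (?l w)
      - (\<Sum>M | M \<subseteq># T. scale (?l w * (if mset w = M then sgw w else 0)) (nf M))) \<in> J"
    using assms by (intro J_sum word) (simp add: carrier_free_algebra)
  also have "(\<Sum>w\<in>?K. Poly_Mapping.single w (?l w)
      - (\<Sum>M | M \<subseteq># T. scale (?l w * (if mset w = M then sgw w else 0)) (nf M)))
      = p - (\<Sum>M | M \<subseteq># T. scale (cf M p) (nf M))"
  proof -
    have "scale (cf M p) (nf M) = (\<Sum>w\<in>?K. scale (?l w * (if mset w = M then sgw w else 0)) (nf M))" for M
      by (rule poly_mapping_eqI) (simp add: cf_def plift_def lookup_sum sum_distrib_right)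
    moreover have "(\<Sum>w\<in>?K. \<Sum>M | M \<subseteq># T. scale (?l w * (if mset w = M then sgw w else 0)) (nf M))
      = (\<Sum>M | M \<subseteq># T. \<Sum>w\<in>?K. scale (?l w * (if mset w = M then sgw w else 0)) (nf M))"
      by (rule sum.swap)
    ultimately show ?thesis
      using poly_mapping_eq_sum_single[of p] by (simp add: sum_subtractf)
  qed
  finally show ?thesis .
qed

section \<open>The quotient algebra and its monomial basis\<close>

definition coset :: "(nat list \<Rightarrow>\<^sub>0 'k) \<Rightarrow> (nat list \<Rightarrow>\<^sub>0 'k) set" where
  "coset p = J +>\<^bsub>F\<^esub> p"

definition e :: "nat multiset \<Rightarrow> (nat list \<Rightarrow>\<^sub>0 'k) set" where
  "e M = coset (nf M)"

definition \<xi> :: "nat multiset \<Rightarrow> (nat list \<Rightarrow>\<^sub>0 'k) set \<Rightarrow> 'k" where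
  "\<xi> M X = cf M (SOME p. p \<in> X)"

lemma coset_eq: "coset p = {x. x - p \<in> J}"
proof -
  have "x \<in> coset p \<longleftrightarrow> x - p \<in> J" for x
  proof -
    have "x \<in> coset p \<longleftrightarrow> (\<exists>h\<in>J. x = h + p)"
      by (simp only: coset_def a_r_coset_def' free_algebra_simps UN_iff singleton_iff)
    also have "\<dots> \<longleftrightarrow> x - p \<in> J"
      by (metis add_diff_cancel_right' diff_add_cancel)
    finally show ?thesis .
  qed
  then show ?thesis by blast
qed

lemma coset_eqI: "p - p' \<in> J \<Longrightarrow> coset p = coset p'"
  using J_add[of _ "p - p'"] J_diff[of _ "p - p'"] by (fastforce simp: coset_eq)

lemma A_eq: "A = quotient_algebra F J"
  by (simp add: quantum_complete_intersection_def)

lemma carrier_A: "carrier A = coset ` carrier F"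
  unfolding A_eq by (auto simp: quotient_algebra_def FactRing_def A_RCOSETS_def' coset_def)

lemma coset_closed: "p \<in> carrier F \<Longrightarrow> coset p \<in> carrier A"
  by (simp add: carrier_A)

lemma
  assumes "p \<in> carrier F" "p' \<in> carrier F"
  shows coset_mult: "coset p \<otimes>\<^bsub>A\<^esub> coset p' = coset (p * p')"
    and coset_add: "coset p \<oplus>\<^bsub>A\<^esub> coset p' = coset (p + p')"
  using ring_hom_mult[OF ideal.rcos_ring_hom[OF ideal_J] assms]
    ring_hom_add[OF ideal.rcos_ring_hom[OF ideal_J] assms]
  unfolding A_eq by (simp_all add: quotient_algebra_def coset_def)

lemma coset_one: "\<one>\<^bsub>A\<^esub> = coset 1"
  unfolding A_eq by (simp add: quotient_algebra_def FactRing_def coset_def)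

lemma coset_smult: "c \<odot>\<^bsub>A\<^esub> coset p = coset (scale c p)"
proof -
  have "coset (scale c x) = coset (scale c p)" if "x \<in> coset p" for x
    using J_scale[of "x - p" c] that by (intro coset_eqI) (simp add: coset_eq flip: scale_diff)
  moreover have "p \<in> coset p" by (simp add: coset_eq J_zero)
  ultimately have "(\<Union>x\<in>coset p. coset (scale c x)) = coset (scale c p)" by blast
  then show ?thesis unfolding A_eq by (simp add: quotient_algebra_def coset_def)
qed

lemma ring_A: "ring A"
  unfolding A_eq by (rule ring_quotient_algebra[OF ideal_J])

lemma vector_space_A: "vector_space_record A"
proof (rule vector_space_recordI)
  show "abelian_group A" by (rule ring.is_abelian_group[OF ring_A])
  fix c d X Y assume X: "X \<in> carrier A"
  then obtain p where p: "X = coset p" "p \<in> carrier F" by (auto simp: carrier_A)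
  show "c \<odot>\<^bsub>A\<^esub> X \<in> carrier A"
    using p by (simp add: coset_smult coset_closed scale_in_free_algebra)
  show "(c + d) \<odot>\<^bsub>A\<^esub> X = c \<odot>\<^bsub>A\<^esub> X \<oplus>\<^bsub>A\<^esub> d \<odot>\<^bsub>A\<^esub> X"
  proof -
    have "scale (c + d) p = scale c p + scale d p"
      by (rule poly_mapping_eqI) (simp add: lookup_add distrib_right)
    then show ?thesis using p by (simp add: coset_smult coset_add scale_in_free_algebra)
  qed
  show "(c * d) \<odot>\<^bsub>A\<^esub> X = c \<odot>\<^bsub>A\<^esub> (d \<odot>\<^bsub>A\<^esub> X)"
    unfolding p coset_smult
    by (rule arg_cong[of _ _ coset], rule poly_mapping_eqI) simp
  show "1 \<odot>\<^bsub>A\<^esub> X = X"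
    unfolding p coset_smult
    by (rule arg_cong[of _ _ coset], rule poly_mapping_eqI) simp
  assume Y: "Y \<in> carrier A"
  then obtain r where r: "Y = coset r" "r \<in> carrier F" by (auto simp: carrier_A)
  show "c \<odot>\<^bsub>A\<^esub> (X \<oplus>\<^bsub>A\<^esub> Y) = c \<odot>\<^bsub>A\<^esub> X \<oplus>\<^bsub>A\<^esub> c \<odot>\<^bsub>A\<^esub> Y"
    using p r by (simp add: coset_smult coset_add scale_in_free_algebra scale_add)
qed

lemma assoc_algebra_A: "assoc_algebra A"
  unfolding assoc_algebra_def
proof (intro conjI allI ballI)
  fix c X Y assume "X \<in> carrier A" "Y \<in> carrier A"
  then obtain p r where pr: "X = coset p" "p \<in> carrier F" "Y = coset r" "r \<in> carrier F"
    by (auto simp: carrier_A)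
  show "(c \<odot>\<^bsub>A\<^esub> X) \<otimes>\<^bsub>A\<^esub> Y = c \<odot>\<^bsub>A\<^esub> (X \<otimes>\<^bsub>A\<^esub> Y)"
    using pr by (simp add: coset_smult coset_mult scale_in_free_algebra scale_mult_left
        free_algebra_closed)
  show "X \<otimes>\<^bsub>A\<^esub> (c \<odot>\<^bsub>A\<^esub> Y) = c \<odot>\<^bsub>A\<^esub> (X \<otimes>\<^bsub>A\<^esub> Y)"
    using pr by (simp add: coset_smult coset_mult scale_in_free_algebra scale_mult_right
        free_algebra_closed)
qed (rule ring_A vector_space_A)+

text \<open>The chosen representative differs from \<open>p\<close> by an element of
  \<open>J\<close>, which \<open>cf_J\<close> makes invisible.\<close>

lemma \<xi>_coset:
  assumes "M \<subseteq># T"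
  shows "\<xi> M (coset p) = cf M p"
proof -
  have "(SOME x. x \<in> coset p) \<in> coset p"
    by (rule someI[of _ p]) (simp add: coset_eq J_zero)
  then have "cf M ((SOME x. x \<in> coset p) - p) = 0"
    by (intro cf_J assms) (simp add: coset_eq)
  then show ?thesis by (simp add: \<xi>_def cf_def plift_diff)
qed

lemma nf_closed: "M \<subseteq># T \<Longrightarrow> nf M \<in> carrier F"
  unfolding nf_def using set_T by (intro single_in_free_algebra) simp

sublocale monomial_algebra A T e \<xi> \<kappa>
proof
  show "vector_space_record A" by (rule vector_space_A)
  show "finite {M. M \<subseteq># T}" by (rule finite_submultisets)
  show "assoc_algebra A" by (rule assoc_algebra_A)
  show "\<one>\<^bsub>A\<^esub> = e {#}"
    by (simp add: coset_one e_def nf_def zero_list_def flip: single_one)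
  show "T \<noteq> {#}"
    using count_T[of 1] n a[of 1] by auto
  show "\<kappa> {#i#} {#i#} = 1" for i by (simp add: sg_def)
  fix M N assume M: "M \<in> {M. M \<subseteq># T}"
  then show "e M \<in> carrier A" by (simp add: e_def coset_closed nf_closed)
  show "\<xi> M \<in> dual_space A"
    using M by (intro dualI)
      (auto simp: carrier_A coset_add coset_smult \<xi>_coset cf_def plift_add plift_scale)
  show "\<xi> M (e N) = (if M = N then 1 else 0)"
    using M by (simp add: e_def \<xi>_coset cf_nf)
next
  fix X Y assume "X \<in> carrier A" "Y \<in> carrier A" 
    and eq: "\<And>M. M \<in> {M. M \<subseteq># T} \<Longrightarrow> \<xi> M X = \<xi> M Y"
  then obtain p r where pr: "X = coset p" "p \<in> carrier F" "Y = coset r" "r \<in> carrier F"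
    by (auto simp: carrier_A)
  have "cf M p = cf M r" if "M \<subseteq># T" for M
    using eq[of M] that by (simp add: pr \<xi>_coset)
  \<comment> \<open>Equal coordinates mean equal normal forms, and \<open>p\<close> and
    \<open>r\<close> are both congruent to theirs modulo \<open>J\<close>.\<close>
  then have "(\<Sum>M | M \<subseteq># T. scale (cf M p) (nf M)) = (\<Sum>M | M \<subseteq># T. scale (cf M r) (nf M))"
    by simp
  then have "p - r \<in> J"
    using J_diff[OF normal_form_mod_J[OF pr(2)] normal_form_mod_J[OF pr(4)]] by simp
  then show "X = Y" unfolding pr by (rule coset_eqI)
next
  fix X Y R assume "X \<in> carrier A" "Y \<in> carrier A" and R: "R \<subseteq># T"
  then obtain p r where pr: "X = coset p" "p \<in> carrier F" "Y = coset r" "r \<in> carrier F"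
    by (auto simp: carrier_A)
  have "\<xi> R (X \<otimes>\<^bsub>A\<^esub> Y) = cf R (p * r)"
    using pr R by (simp add: coset_mult \<xi>_coset)
  also have "\<dots> = (\<Sum>M | M \<subseteq># R. \<kappa> M (R - M) * \<xi> M X * \<xi> (R - M) Y)"
    unfolding cf_mult pr using R
    by (intro sum.cong refl)
      (auto simp: \<xi>_coset subset_mset.order_trans[OF diff_subset_eq_self] intro: subset_mset.order_trans)
  finally show "\<xi> R (X \<otimes>\<^bsub>A\<^esub> Y) = (\<Sum>M | M \<subseteq># R. \<kappa> M (R - M) * \<xi> M X * \<xi> (R - M) Y)" .
qed (rule \<kappa>_add_left \<kappa>_add_right \<kappa>_square)+

lemma no_bialgebra_qci:
  assumes "i \<in> {1..n}" "\<nexists>m. a i = CHAR('k) ^ m"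
  shows "\<not> admits_bialgebra A"
proof (rule no_bialgebra)
  show "i \<in># T" using assms(1) a[of i] by (simp add: count_T flip: count_greater_zero_iff)
  show "\<nexists>m. Suc (count T i) = CHAR('k) ^ m" using assms a[of i] by (simp add: count_T)
qed

end

theorem corollary4p5:
  fixes n :: nat and a :: "nat \<Rightarrow> nat" and q :: "nat \<Rightarrow> nat \<Rightarrow> 'k::field"
  assumes "n \<ge> 2"
    and "\<And>i. i \<in> {1..n} \<Longrightarrow> a i \<ge> 2"
    and "\<And>i. i \<in> {1..n} \<Longrightarrow> q i i = - 1"
    and "\<And>i j. i \<in> {1..n} \<Longrightarrow> j \<in> {1..n} \<Longrightarrow> q i j * q j i = 1"
    and "\<exists>s :: 'k. s ^ 2 = - 1"
    and "\<And>i j. i \<in> {1..n} \<Longrightarrow> j \<in> {1..n} \<Longrightarrow> (q i j) ^ 2 = 1"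
  shows "admits_bi_frobenius_algebra (quantum_complete_intersection n q a)
    \<and> ((\<exists>i\<in>{1..n}. \<not> (\<exists>m. a i = CHAR('k) ^ m)) \<longrightarrow>
         \<not> admits_bialgebra (quantum_complete_intersection n q a) \<and>
         \<not> admits_hopf_algebra (quantum_complete_intersection n q a))
    \<and> (CHAR('k) = 0 \<longrightarrow>
         \<not> admits_bialgebra (quantum_complete_intersection n q a) \<and>
         \<not> admits_hopf_algebra (quantum_complete_intersection n q a))"
proof -
  let ?A = "quantum_complete_intersection n q a"
  interpret qci n q a by unfold_locales (use assms in auto)
  obtain s :: 'k where "s ^ 2 = - 1" using assms(5) by blast
  then obtain c where "bi_frobenius_data ?A T e \<xi> \<kappa> c"
    using bi_frobenius_data_exists by blast
  then have bi_frobenius: "admits_bi_frobenius_algebra ?A"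
    by (rule bi_frobenius_data.admits_bi_frobenius)
  have hopf: "admits_bialgebra ?A" if "admits_hopf_algebra ?A"
    using that by (auto simp: admits_bialgebra_def admits_hopf_algebra_def hopf_algebra_def)
  have no: "\<not> admits_bialgebra ?A" if "\<exists>i\<in>{1..n}. \<not> (\<exists>m. a i = CHAR('k) ^ m)"
    using that no_bialgebra_qci by blast
  \<comment> \<open>The powers of 0 are 1 (for exponent 0) and 0, whereas \<open>a 1\<close> is at
    least 2.\<close>
  have "\<not> (\<exists>m. a 1 = CHAR('k) ^ m)" if "CHAR('k) = 0"
    using a[of 1] assms(1) that by (auto simp: power_0_left)
  moreover have "1 \<in> {1..n}" using assms(1) by simp
  ultimately have "\<exists>i\<in>{1..n}. \<not> (\<exists>m. a i = CHAR('k) ^ m)" if "CHAR('k) = 0"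
    using that by blast
  with bi_frobenius hopf no show ?thesis by blast
qed

end
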